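(* If $G$ is a compactly generated, solvable-by-compact, locally compact group, then $\mathrm{asdim}(G)\leq h(G)$.
   Context: Locally compact groups are Hausdorff. $G$ is solvable-by-compact if it has a closed normal solvable subgroup $N$ with $G/N$ compact. The Hirsch length $h(G)$ of a topological group is the maximum number (possibly infinity) of infinite cyclic factors $G_{i+1}/G_i$ in all possible finite series $1=G_0\unlhd G_1\unlhd\cdots\unlhd G_m=G$ of closed subgroups of $G$ (each $G_i$ normal in $G_{i+1}$; the other factors are arbitrary). The asymptotic dimension $\mathrm{asdim}(G)$ of a second countable locally compact group is its (Gromov) asymptotic dimension with respect to any plig metric, i.e. a proper left-invariant metric generating the topology (any two are coarsely equivalent); for general locally compact $G$, $\mathrm{asdim}(G)$ is the supremum of $\mathrm{asdim}(K)$ over compactly generated closed subgroups $K\le G$, equivalently the asymptotic dimension of $G$ with its canonical left coarse structure, whose controlled sets are the $E\subseteq G\times G$ with $\{x^{-1}y:(x,y)\in E\}$ relatively compact. *)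

theory Defs
  imports
    "HOL-Analysis.Analysis"
    "HOL-Algebra.Elementary_Groups"
    "HOL-Algebra.Solvable_Groups"
begin

no_notation eq_closure_of (\<open>closure'_of\<index>\<close>)

section \<open>Topological groups\<close>

locale topological_group = group G for G (structure) +
  fixes T :: "'a topology"
  assumes topspace_eq_carrier: "topspace T = carrier G"
    and continuous_mult: "continuous_map (prod_topology T T) T (\<lambda>(x, y). x \<otimes> y)"
    and continuous_inv: "continuous_map T T (\<lambda>x. inv x)"

definition locally_compact_group :: "('a, 'b) monoid_scheme \<Rightarrow> 'a topology \<Rightarrow> bool" where
  "locally_compact_group G T \<longleftrightarrow>
     topological_group G T \<and> Hausdorff_space T \<and> locally_compact_space T"

definition compactly_generated_group :: "('a, 'b) monoid_scheme \<Rightarrow> 'a topology \<Rightarrow> bool" where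
  "compactly_generated_group G T \<longleftrightarrow> (\<exists>K. compactin T K \<and> generate G K = carrier G)"

definition FactGroup_topology ::
    "('a, 'b) monoid_scheme \<Rightarrow> 'a topology \<Rightarrow> 'a set \<Rightarrow> 'a set topology" where
  "FactGroup_topology G T N =
     topology (\<lambda>U. U \<subseteq> carrier (G Mod N) \<and> openin T {x \<in> carrier G. N #>\<^bsub>G\<^esub> x \<in> U})"

definition solvable_by_compact :: "('a, 'b) monoid_scheme \<Rightarrow> 'a topology \<Rightarrow> bool" where
  "solvable_by_compact G T \<longleftrightarrow>
     (\<exists>N. N \<lhd> G \<and> closedin T N \<and> solvable (G\<lparr>carrier := N\<rparr>) \<and>
          compact_space (FactGroup_topology G T N))"

section \<open>Hirsch length\<close>

definition closed_subnormal_series ::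
    "('a, 'b) monoid_scheme \<Rightarrow> 'a topology \<Rightarrow> nat \<Rightarrow> (nat \<Rightarrow> 'a set) \<Rightarrow> bool" where
  "closed_subnormal_series G T m H \<longleftrightarrow>
     H 0 = {\<one>\<^bsub>G\<^esub>} \<and> H m = carrier G \<and>
     (\<forall>i\<le>m. subgroup (H i) G \<and> closedin T (H i)) \<and>
     (\<forall>i<m. H i \<lhd> G\<lparr>carrier := H (Suc i)\<rparr>)"

definition infinite_cyclic_factors ::
    "('a, 'b) monoid_scheme \<Rightarrow> nat \<Rightarrow> (nat \<Rightarrow> 'a set) \<Rightarrow> nat set" where
  "infinite_cyclic_factors G m H =
     {i. i < m \<and> cyclic_group (G\<lparr>carrier := H (Suc i)\<rparr> Mod H i) \<and>
         infinite (carrier (G\<lparr>carrier := H (Suc i)\<rparr> Mod H i))}"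

definition hirsch_length :: "('a, 'b) monoid_scheme \<Rightarrow> 'a topology \<Rightarrow> enat" where
  "hirsch_length G T =
     Sup {enat (card (infinite_cyclic_factors G m H)) | m H. closed_subnormal_series G T m H}"

section \<open>Asymptotic dimension\<close>

text \<open>A coarse structure on \<open>X\<close> is given by its collection \<open>C\<close> of controlled sets. As for
  metric spaces, \<open>asdim \<le> n\<close> means that for every scale \<open>E \<in> C\<close> there is a uniformly bounded
  cover of \<open>X\<close> splitting into \<open>n + 1\<close> families \<open>\<U> 0, \<dots>, \<U> n\<close>, each of them \<open>E\<close>-disjoint.\<close>

definition coarse_asdim_le :: "'a set \<Rightarrow> ('a \<times> 'a) set set \<Rightarrow> nat \<Rightarrow> bool" where
  "coarse_asdim_le X C n \<longleftrightarrow>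
     (\<forall>E\<in>C. \<exists>\<U> :: nat \<Rightarrow> 'a set set.
        (\<Union>i\<le>n. \<Union>(\<U> i)) = X \<and>
        (\<Union>i\<le>n. \<Union>A\<in>\<U> i. A \<times> A) \<in> C \<and>
        (\<forall>i\<le>n. \<forall>A\<in>\<U> i. \<forall>B\<in>\<U> i. A \<noteq> B \<longrightarrow> (A \<times> B) \<inter> E = {}))"

definition coarse_asdim :: "'a set \<Rightarrow> ('a \<times> 'a) set set \<Rightarrow> enat" where
  "coarse_asdim X C = Inf {enat n | n. coarse_asdim_le X C n}"

definition left_coarse_structure ::
    "('a, 'b) monoid_scheme \<Rightarrow> 'a topology \<Rightarrow> ('a \<times> 'a) set set" where
  "left_coarse_structure G T =
     {E. E \<subseteq> carrier G \<times> carrier G \<and>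
         compactin T (T closure_of ((\<lambda>(x, y). inv\<^bsub>G\<^esub> x \<otimes>\<^bsub>G\<^esub> y) ` E))}"

definition asdim :: "('a, 'b) monoid_scheme \<Rightarrow> 'a topology \<Rightarrow> enat" where
  "asdim G T = coarse_asdim (carrier G) (left_coarse_structure G T)"

section \<open>Basic facts\<close>

lemma openin_FactGroup_topology:
  "openin (FactGroup_topology G T N) U \<longleftrightarrow>
     U \<subseteq> carrier (G Mod N) \<and> openin T {x \<in> carrier G. N #>\<^bsub>G\<^esub> x \<in> U}"
proof -
  let ?P = "\<lambda>U. {x \<in> carrier G. N #>\<^bsub>G\<^esub> x \<in> U}"
  have "?P (A \<inter> B) = ?P A \<inter> ?P B" for A B by auto
  moreover have "?P (\<Union>\<K>) = (\<Union>K\<in>\<K>. ?P K)" for \<K> by auto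
  ultimately have "istopology (\<lambda>U. U \<subseteq> carrier (G Mod N) \<and> openin T (?P U))"
    unfolding istopology_def by (auto intro!: openin_Int openin_Union)
  then show ?thesis
    by (simp add: FactGroup_topology_def)
qed

lemma (in topological_group) quotient_map_FactGroup_topology:
  "quotient_map T (FactGroup_topology G T N) (\<lambda>x. N #> x)"
proof -
  have "{x \<in> carrier G. N #> x \<in> carrier (G Mod N)} = topspace T"
    by (auto simp: carrier_FactGroup topspace_eq_carrier)
  then have "openin (FactGroup_topology G T N) (carrier (G Mod N))"
    by (simp add: openin_FactGroup_topology)
  then have "topspace (FactGroup_topology G T N) = carrier (G Mod N)"
    by (meson openin_FactGroup_topology openin_subset openin_topspace subset_antisym)
  then show ?thesis
    by (simp add: quotient_map_def openin_FactGroup_topology topspace_eq_carrier carrier_FactGroup)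
qed

text \<open>If the topology comes from a proper left-invariant metric, then the left coarse structure is
  the metric one, so that \<open>asdim\<close> is Gromov's asymptotic dimension of the metric.\<close>

lemma (in topological_group) left_coarse_structure_eq_metric:
  assumes M: "Metric_space (carrier G) d" and T: "Metric_space.mtopology (carrier G) d = T"
    and left_invariant: "\<And>g x y. \<lbrakk>g \<in> carrier G; x \<in> carrier G; y \<in> carrier G\<rbrakk>
      \<Longrightarrow> d (g \<otimes> x) (g \<otimes> y) = d x y"
    and proper: "\<And>x r. compactin T (Metric_space.mcball (carrier G) d x r)"
  shows "left_coarse_structure G T =
    {E. E \<subseteq> carrier G \<times> carrier G \<and> (\<exists>r. \<forall>(x, y)\<in>E. d x y \<le> r)}"
proof -
  interpret Metric_space "carrier G" d by (rule M)
  have d1: "d \<one> (inv x \<otimes> y) = d x y" if "x \<in> carrier G" "y \<in> carrier G" for x y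
    using left_invariant[of x \<one> "inv x \<otimes> y"] that by (simp add: m_assoc[symmetric])
  have "compactin T (T closure_of ((\<lambda>(x, y). inv x \<otimes> y) ` E)) \<longleftrightarrow> (\<exists>r. \<forall>(x, y)\<in>E. d x y \<le> r)"
    if E: "E \<subseteq> carrier G \<times> carrier G" for E
  proof -
    let ?S = "(\<lambda>(x, y). inv x \<otimes> y) ` E"
    have S: "?S \<subseteq> carrier G" using E by auto
    have "?S \<subseteq> mcball \<one> r \<longleftrightarrow> (\<forall>(x, y)\<in>E. d x y \<le> r)" for r
    proof -
      have "inv x \<otimes> y \<in> mcball \<one> r \<longleftrightarrow> d x y \<le> r" if "(x, y) \<in> E" for x y
        using that E d1[of x y] by auto
      then show ?thesis
        unfolding image_subset_iff by (intro ball_cong) auto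
    qed
    moreover have "compactin T (T closure_of ?S) \<longleftrightarrow> (\<exists>r. ?S \<subseteq> mcball \<one> r)"
    proof
      assume "compactin T (T closure_of ?S)"
      then have "mbounded (T closure_of ?S)"
        using compactin_imp_mbounded T by simp
      then have "mbounded ?S"
        using S closure_of_subset[of ?S T] mbounded_subset by (metis topspace_eq_carrier)
      then show "\<exists>r. ?S \<subseteq> mcball \<one> r"
        using mbounded_insert[of \<one> ?S] mbounded_alt[of "insert \<one> ?S"] S
        by (auto simp: subset_iff)
    next
      assume "\<exists>r. ?S \<subseteq> mcball \<one> r"
      then obtain r where "?S \<subseteq> mcball \<one> r" ..
      then have "T closure_of ?S \<subseteq> mcball \<one> r"
        using closedin_mcball T by (metis closure_of_minimal)
      then show "compactin T (T closure_of ?S)"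
        using closed_compactin closedin_closure_of proper by blast
    qed
    ultimately show ?thesis by simp
  qed
  then show ?thesis
    by (auto simp: left_coarse_structure_def)
qed

end

theory Submission
  imports Defs
begin

text \<open>The closures of the terms of a solvable series of \<open>N\<close> have abelian successive quotients. In
  such a quotient every element generates either a discrete infinite cyclic subgroup or a relatively
  compact one (Weil). Dividing out discrete infinite cyclic subgroups as long as possible yields, if
  the Hirsch length is finite, a closed series of \<open>G\<close> whose factors are infinite cyclic and discrete,
  or locally elliptic (every compact subset lies in a compact subgroup), or compact. Factors of the
  last two kinds do not raise the asymptotic dimension, and an infinite cyclic one raises it by at
  most one. All estimates are carried out for subsets of \<open>G\<close>, so that neither subgroups nor quotients
  need a topology of their own.\<close>

text \<open>Points x and y are close when \<open>inv x \<otimes> y\<close> lies in a fixed compact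
  set. Left translations preserve this expression, and right multiplication by a compact set moves
  points by a bounded amount; nearly every estimate combines these two moves. Commutativity of a
  section K/H makes every intermediate subgroup normal in K. Hence cyclic groups can be adjoined one
  after another inside K, each stage ends a series that continues to K, and product sets such as
  \<open>B <#> L\<close> can be subgroups. The two sides of the inequality are linked by a single
  number k: a closed series with at least k infinite cyclic factors comes together with covers
  showing that the asymptotic dimension is at most k. A lower bound on the count suffices, since the
  Hirsch length is a supremum. The delicate step is the infinite cyclic extension. Good covers of
  slabs of bounded height exist at every scale, but pieces of one colour in adjacent slabs can join
  into unbounded chains. The one additional colour pays for interrupting every colour at regular
  heights.\<close>

locale lc_group = topological_group G T for G (structure) and T :: "'a topology" +
  assumes Hausdorff: "Hausdorff_space T"
    and locally_compact: "locally_compact_space T"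
begin

lemma inv_mult_cancel [simp]:
  assumes "x \<in> carrier G" "y \<in> carrier G"
  shows "inv x \<otimes> (x \<otimes> y) = y" "x \<otimes> (inv x \<otimes> y) = y"
  using assms by (simp_all flip: m_assoc)

subsection \<open>Compact sets\<close>

lemma compactin_subset_carrier: "compactin T A \<Longrightarrow> A \<subseteq> carrier G"
  using compactin_subset_topspace topspace_eq_carrier by metis

lemma compactin_set_mult:
  assumes "compactin T A" "compactin T B"
  shows "compactin T (A <#> B)"
proof -
  have "compactin (prod_topology T T) (A \<times> B)"
    using assms by (simp add: compactin_Times)
  then have "compactin T ((\<lambda>(x, y). x \<otimes> y) ` (A \<times> B))"
    using continuous_mult image_compactin by blast
  moreover have "(\<lambda>(x, y). x \<otimes> y) ` (A \<times> B) = A <#> B"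
    by (auto simp: set_mult_def)
  ultimately show ?thesis by simp
qed

lemma compactin_m_inv: "compactin T A \<Longrightarrow> compactin T (m_inv G ` A)"
  using continuous_inv image_compactin by blast

lemma compactin_finite: "finite A \<Longrightarrow> A \<subseteq> carrier G \<Longrightarrow> compactin T A"
  by (simp add: finite_imp_compactin topspace_eq_carrier)

lemma set_multI: "x \<in> A \<Longrightarrow> y \<in> B \<Longrightarrow> x \<otimes> y \<in> A <#> B"
  by (auto simp: set_mult_def)

definition symmetrization :: "'a set \<Rightarrow> 'a set" where
  "symmetrization C = insert \<one> (C \<union> m_inv G ` C)"

lemma compactin_symmetrization: "compactin T C \<Longrightarrow> compactin T (symmetrization C)"
  unfolding symmetrization_def
  using compactin_Un[OF compactin_finite[of "{\<one>}"] compactin_Un[OF _ compactin_m_inv]] by simp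

lemma inv_in_symmetrization:
  assumes "C \<subseteq> carrier G" "x \<in> symmetrization C"
  shows "inv x \<in> symmetrization C"
  using assms by (auto simp: symmetrization_def subset_iff)

subsection \<open>Asymptotic dimension of subsets\<close>

definition chain_step :: "'a set \<Rightarrow> 'a set \<Rightarrow> 'a rel" where
  "chain_step Y C = {(x, y). x \<in> Y \<and> y \<in> Y \<and> inv x \<otimes> y \<in> C}"

text \<open>The points reachable from x inside Y by steps in C play the role of one member of a
  C-disjoint family. A single subset Y thus replaces a whole colour class of sets. C is not assumed
  symmetric, so these are forward orbits until C is symmetrized.\<close>

definition comps_bounded :: "'a set \<Rightarrow> 'a set \<Rightarrow> 'a set \<Rightarrow> bool" where
  "comps_bounded Y C D \<longleftrightarrow> (\<forall>x\<in>Y. \<forall>y. (x, y) \<in> (chain_step Y C)\<^sup>* \<longrightarrow> inv x \<otimes> y \<in> D)"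

text \<open>The bound D is uniform over all colours and components. C and D range over compact
  subsets of G even when X is small, so X is measured with the coarse structure induced from
  G.\<close>

definition asdim_at_most :: "'a set \<Rightarrow> nat \<Rightarrow> bool" where
  "asdim_at_most X n \<longleftrightarrow>
     (\<forall>C. compactin T C \<longrightarrow>
        (\<exists>D Y. compactin T D \<and> X = (\<Union>i\<le>n. Y i) \<and> (\<forall>i\<le>n. comps_bounded (Y i) C D)))"

lemma chain_in_set: "(x, y) \<in> (chain_step Y C)\<^sup>* \<Longrightarrow> x \<in> Y \<Longrightarrow> y \<in> Y"
  by (induction rule: rtrancl_induct) (auto simp: chain_step_def)

lemma chain_mono:
  assumes "(x, y) \<in> (chain_step Y C)\<^sup>*" "Y \<subseteq> Y'" "C \<subseteq> C'"
  shows "(x, y) \<in> (chain_step Y' C')\<^sup>*"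
proof -
  have "chain_step Y C \<subseteq> chain_step Y' C'"
    using assms(2,3) by (auto simp: chain_step_def)
  then show ?thesis
    using assms(1) rtrancl_mono by blast
qed

lemma chain_sym:
  assumes "(x, y) \<in> (chain_step Y C)\<^sup>*" "Y \<subseteq> carrier G" "\<And>c. c \<in> C \<Longrightarrow> inv c \<in> C"
  shows "(y, x) \<in> (chain_step Y C)\<^sup>*"
proof -
  have "sym (chain_step Y C)"
  proof (rule symI)
    fix a b assume ab: "(a, b) \<in> chain_step Y C"
    then have "inv (inv a \<otimes> b) \<in> C" "a \<in> carrier G" "b \<in> carrier G"
      using assms by (auto simp: chain_step_def)
    then show "(b, a) \<in> chain_step Y C"
      using ab by (simp add: chain_step_def inv_mult_group)
  qed
  then show ?thesis
    using assms(1) by (meson sym_rtrancl symD)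
qed

lemma comps_bounded_mono:
  assumes "comps_bounded Y C D" "Y' \<subseteq> Y" "C' \<subseteq> C" "D \<subseteq> D'"
  shows "comps_bounded Y' C' D'"
  using assms chain_mono[of _ _ Y' C' Y C] unfolding comps_bounded_def by blast

text \<open>A chain in Z keeps its label \<kappa>, since every step does, and \<phi> carries it to a
  chain in one \<open>Y (\<kappa> x)\<close>. Two kinds of \<phi> occur later: bounded displacement
  with a trivial label, and left multiplication by an element depending only on the label, under
  which \<open>inv x \<otimes> y\<close> does not change for points of equal label.\<close>

lemma comps_bounded_map:
  assumes bd: "\<And>x. x \<in> Z \<Longrightarrow> comps_bounded (Y (\<kappa> x)) C' D'"
    and \<phi>: "\<And>x. x \<in> Z \<Longrightarrow> \<phi> x \<in> Y (\<kappa> x)"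
    and \<kappa>: "\<And>x y. \<lbrakk>x \<in> Z; y \<in> Z; inv x \<otimes> y \<in> C\<rbrakk> \<Longrightarrow> \<kappa> x = \<kappa> y"
    and step: "\<And>x y. \<lbrakk>x \<in> Z; y \<in> Z; inv x \<otimes> y \<in> C; \<kappa> x = \<kappa> y\<rbrakk> \<Longrightarrow> inv (\<phi> x) \<otimes> \<phi> y \<in> C'"
    and bwd: "\<And>x y. \<lbrakk>x \<in> Z; y \<in> Z; \<kappa> x = \<kappa> y; inv (\<phi> x) \<otimes> \<phi> y \<in> D'\<rbrakk> \<Longrightarrow> inv x \<otimes> y \<in> D"
  shows "comps_bounded Z C D"
  unfolding comps_bounded_def
proof (intro ballI allI impI)
  fix x y assume x: "x \<in> Z" and xy: "(x, y) \<in> (chain_step Z C)\<^sup>*"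
  have "y \<in> Z \<and> \<kappa> x = \<kappa> y \<and> (\<phi> x, \<phi> y) \<in> (chain_step (Y (\<kappa> x)) C')\<^sup>*"
    using xy
  proof (induction rule: rtrancl_induct)
    case base
    then show ?case using x by simp
  next
    case (step y z)
    then have "z \<in> Z" "inv y \<otimes> z \<in> C" by (auto simp: chain_step_def)
    moreover from this step have "\<kappa> y = \<kappa> z" using \<kappa> by blast
    ultimately have "(\<phi> y, \<phi> z) \<in> chain_step (Y (\<kappa> x)) C'"
      using step.IH \<phi>[of y] \<phi>[of z] assms(4)[of y z] by (auto simp: chain_step_def)
    then show ?case
      using step.IH \<open>z \<in> Z\<close> \<open>\<kappa> y = \<kappa> z\<close> by (auto intro: rtrancl_into_rtrancl)
  qed
  then show "inv x \<otimes> y \<in> D"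
    using bd[OF x] \<phi>[OF x] bwd[OF x, of y] by (auto simp: comps_bounded_def)
qed

text \<open>This is the saturated union of asymptotic dimension theory. An excursion of a C-chain
  from U through V and back to U has displacement in \<open>C <#> (D0 <#> C)\<close>, so it
  shortcuts to a single C1-step in U. Hence a chain starting in U ends within E of its start. If the
  chain from x meets U, both of its ends are compared with a point of U, which gives a quotient of
  two elements of E; a chain that never meets U lies in V.\<close>

lemma comps_bounded_saturated_Un:
  assumes U: "comps_bounded U C1 D1" and V: "comps_bounded V C D0"
    and UV: "U \<subseteq> carrier G" "V \<subseteq> carrier G"
    and C: "\<And>c. c \<in> C \<Longrightarrow> inv c \<in> C" "\<one> \<in> C"
    and C1: "C <#> (D0 <#> C) \<subseteq> C1" and D0: "\<one> \<in> D0"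
    and DD: "D0 \<subseteq> D" "D1 <#> (C <#> D0) \<subseteq> E" "m_inv G ` E <#> E \<subseteq> D"
    and CD: "C \<subseteq> carrier G" "D0 \<subseteq> carrier G" "D1 \<subseteq> carrier G" "D \<subseteq> carrier G" "E \<subseteq> carrier G"
  shows "comps_bounded (U \<union> V) C D"
proof -
  have "C \<subseteq> C1"
  proof
    fix c assume "c \<in> C"
    then have "c \<otimes> (\<one> \<otimes> \<one>) \<in> C <#> (D0 <#> C)" using C D0 by (intro set_multI)
    moreover have "c \<in> carrier G" using CD \<open>c \<in> C\<close> by auto
    ultimately show "c \<in> C1" using C1 by auto
  qed
  \<comment> \<open>Here y is the last point of U visited by the chain; after y the chain runs
    inside V.\<close>
  define near where "near x p \<longleftrightarrow>
      (\<exists>y\<in>U. (x, y) \<in> (chain_step U C1)\<^sup>* \<and>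
        (p = y \<or> (\<exists>z\<in>V. inv y \<otimes> z \<in> C \<and> (z, p) \<in> (chain_step V C)\<^sup>*)))" for x p
  have near: "near x p" if x: "x \<in> U" and p: "(x, p) \<in> (chain_step (U \<union> V) C)\<^sup>*" for x p
    using p
  proof (induction rule: rtrancl_induct)
    case base
    then show ?case using x by (auto simp: near_def)
  next
    case (step p q)
    then have pq: "p \<in> U \<union> V" "q \<in> U \<union> V" "inv p \<otimes> q \<in> C" by (auto simp: chain_step_def)
    obtain y where y: "y \<in> U" "(x, y) \<in> (chain_step U C1)\<^sup>*"
      and p: "p = y \<or> (\<exists>z\<in>V. inv y \<otimes> z \<in> C \<and> (z, p) \<in> (chain_step V C)\<^sup>*)"
      using step.IH by (auto simp: near_def)
    show ?case
    proof (cases "q \<in> U")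
      case True
      have "inv y \<otimes> q \<in> C1"
        using p
      proof
        assume "p = y"
        then show ?thesis using pq \<open>C \<subseteq> C1\<close> by auto
      next
        assume "\<exists>z\<in>V. inv y \<otimes> z \<in> C \<and> (z, p) \<in> (chain_step V C)\<^sup>*"
        then obtain z where z: "z \<in> V" "inv y \<otimes> z \<in> C" "(z, p) \<in> (chain_step V C)\<^sup>*" by blast
        then have "inv z \<otimes> p \<in> D0" using V by (auto simp: comps_bounded_def)
        then have "(inv y \<otimes> z) \<otimes> ((inv z \<otimes> p) \<otimes> (inv p \<otimes> q)) \<in> C1"
          using C1 z pq by (blast intro: set_multI)
        moreover have "y \<in> carrier G" "z \<in> carrier G" "p \<in> carrier G" "q \<in> carrier G"
          using y z pq UV by auto
        ultimately show ?thesis by (simp add: m_assoc)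
      qed
      then have "(x, q) \<in> (chain_step U C1)\<^sup>*"
        using y True by (auto simp: chain_step_def intro: rtrancl_into_rtrancl)
      then show ?thesis using True by (auto simp: near_def)
    next
      case False
      then have "q \<in> V" using pq by auto
      from p have "\<exists>z\<in>V. inv y \<otimes> z \<in> C \<and> (z, q) \<in> (chain_step V C)\<^sup>*"
      proof
        assume "p = y"
        then show ?thesis using pq \<open>q \<in> V\<close> by blast
      next
        assume "\<exists>z\<in>V. inv y \<otimes> z \<in> C \<and> (z, p) \<in> (chain_step V C)\<^sup>*"
        then obtain z where z: "z \<in> V" "inv y \<otimes> z \<in> C" "(z, p) \<in> (chain_step V C)\<^sup>*" by blast
        then have "(p, q) \<in> chain_step V C"
          using chain_in_set[OF z(3,1)] pq \<open>q \<in> V\<close> by (auto simp: chain_step_def)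
        then show ?thesis using z by (meson rtrancl_into_rtrancl)
      qed
      then show ?thesis using y by (auto simp: near_def)
    qed
  qed
  have E: "inv x \<otimes> p \<in> E" if x: "x \<in> U" and p: "(x, p) \<in> (chain_step (U \<union> V) C)\<^sup>*" for x p
  proof -
    obtain y where y: "y \<in> U" "(x, y) \<in> (chain_step U C1)\<^sup>*"
      and py: "p = y \<or> (\<exists>z\<in>V. inv y \<otimes> z \<in> C \<and> (z, p) \<in> (chain_step V C)\<^sup>*)"
      using near[OF x p] by (auto simp: near_def)
    have "inv x \<otimes> y \<in> D1" using U x y by (auto simp: comps_bounded_def)
    have G: "x \<in> carrier G" "y \<in> carrier G" using x y UV by auto
    from py obtain z where z: "inv y \<otimes> z \<in> C" "inv z \<otimes> p \<in> D0" "z \<in> carrier G"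
    proof
      assume "p = y" then show ?thesis using that[of y] G C D0 by simp
    next
      assume "\<exists>z\<in>V. inv y \<otimes> z \<in> C \<and> (z, p) \<in> (chain_step V C)\<^sup>*"
      then show ?thesis using that V UV by (auto simp: comps_bounded_def)
    qed
    have "p \<in> carrier G" using chain_in_set[OF p] x UV by auto
    have "(inv x \<otimes> y) \<otimes> ((inv y \<otimes> z) \<otimes> (inv z \<otimes> p)) \<in> E"
      using DD z \<open>inv x \<otimes> y \<in> D1\<close> by (blast intro: set_multI)
    then show ?thesis using G z \<open>p \<in> carrier G\<close> by (simp add: m_assoc)
  qed
  show ?thesis
    unfolding comps_bounded_def
  proof (intro ballI allI impI)
    fix x p assume x: "x \<in> U \<union> V" and p: "(x, p) \<in> (chain_step (U \<union> V) C)\<^sup>*"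
    have G: "x \<in> carrier G" "p \<in> carrier G" using chain_in_set[OF p] x UV by auto
    show "inv x \<otimes> p \<in> D"
    proof (cases "\<exists>y\<in>U. (x, y) \<in> (chain_step (U \<union> V) C)\<^sup>*")
      case True
      then obtain y where y: "y \<in> U" "(x, y) \<in> (chain_step (U \<union> V) C)\<^sup>*" by blast
      have yx: "(y, x) \<in> (chain_step (U \<union> V) C)\<^sup>*"
        using chain_sym[OF y(2)] UV C by auto
      then have "inv y \<otimes> x \<in> E" "inv y \<otimes> p \<in> E"
        using E y p by (blast, meson E y p rtrancl_trans)
      then have "inv (inv y \<otimes> x) \<otimes> (inv y \<otimes> p) \<in> D"
        using DD by (blast intro: set_multI)
      then show ?thesis
        using G y UV by (simp add: inv_mult_group m_assoc subset_iff)
    next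
      case False
      have "(x, q) \<in> (chain_step V C)\<^sup>*" if "(x, q) \<in> (chain_step (U \<union> V) C)\<^sup>*" for q
        using that
      proof (induction rule: rtrancl_induct)
        case (step q r)
        then have "q \<notin> U" "r \<notin> U" using False by (auto intro: rtrancl_into_rtrancl)
        then have "(q, r) \<in> chain_step V C" using step by (auto simp: chain_step_def)
        then show ?case using step by (meson rtrancl_into_rtrancl)
      qed simp
      moreover have "x \<in> V" using False x by auto
      ultimately show ?thesis using V DD p by (auto simp: comps_bounded_def)
    qed
  qed
qed

section \<open>Permanence properties: subsets, compact thickenings, double covers, locally elliptic
  sections\<close>

lemma asdim_at_most_subset:
  assumes "asdim_at_most X n" "X' \<subseteq> X"
  shows "asdim_at_most X' n"
  unfolding asdim_at_most_def
proof (intro allI impI)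
  fix C assume "compactin T C"
  then obtain D Y where D: "compactin T D" and Y: "X = (\<Union>i\<le>n. Y i)" "\<forall>i\<le>n. comps_bounded (Y i) C D"
    using assms(1) by (auto simp: asdim_at_most_def)
  have "X' = (\<Union>i\<le>n. Y i \<inter> X')" using Y assms(2) by auto
  moreover have "\<forall>i\<le>n. comps_bounded (Y i \<inter> X') C D"
    using Y by (auto intro: comps_bounded_mono)
  ultimately show "\<exists>D Y. compactin T D \<and> X' = (\<Union>i\<le>n. Y i) \<and> (\<forall>i\<le>n. comps_bounded (Y i) C D)"
    using D by (intro exI[of _ D] exI[of _ "\<lambda>i. Y i \<inter> X'"]) auto
qed

text \<open>Every point of the product differs from a chosen point \<phi> x of the cover of X by a
  right factor in Q, so it has bounded displacement. The errors at both ends of a step enlarge C to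
  \<open>?C'\<close> and D to \<open>?D\<close>.\<close>

lemma asdim_at_most_set_mult:
  assumes X: "asdim_at_most X n" "X \<subseteq> carrier G" and Q: "compactin T Q"
  shows "asdim_at_most (X <#> Q) n"
  unfolding asdim_at_most_def
proof (intro allI impI)
  fix C assume C: "compactin T C"
  let ?C' = "Q <#> (C <#> m_inv G ` Q)"
  have "compactin T ?C'" using C Q by (intro compactin_set_mult compactin_m_inv)
  then obtain D Y where D: "compactin T D" and Y: "X = (\<Union>i\<le>n. Y i)"
    and bd: "\<forall>i\<le>n. comps_bounded (Y i) ?C' D"
    using X(1) by (auto simp: asdim_at_most_def)
  have QG: "Q \<subseteq> carrier G" using Q compactin_subset_carrier by blast
  let ?D = "m_inv G ` Q <#> (D <#> Q)"
  have "comps_bounded (Y i <#> Q) C ?D" if i: "i \<le> n" for i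
  proof -
    have "\<exists>y. y \<in> Y i \<and> inv y \<otimes> x \<in> Q" if x: "x \<in> Y i <#> Q" for x
    proof -
      obtain y q where "y \<in> Y i" "q \<in> Q" "x = y \<otimes> q" using x unfolding set_mult_def by blast
      moreover from this have "y \<in> carrier G" "q \<in> carrier G" using i Y X QG by auto
      ultimately show ?thesis by auto
    qed
    then obtain \<phi> where \<phi>: "\<And>x. x \<in> Y i <#> Q \<Longrightarrow> \<phi> x \<in> Y i \<and> inv (\<phi> x) \<otimes> x \<in> Q"
      by metis
    have YG: "Y i \<subseteq> carrier G" using i Y X by auto
    then have YQG: "Y i <#> Q \<subseteq> carrier G" using QG set_mult_closed by blast
    show ?thesis
    proof (rule comps_bounded_map[where Y = "\<lambda>_::unit. Y i" and \<kappa> = "\<lambda>_. ()" and \<phi> = \<phi>])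
      show "comps_bounded (Y i) ?C' D" using bd i by auto
    next
      fix x y assume xy: "x \<in> Y i <#> Q" "y \<in> Y i <#> Q" "inv x \<otimes> y \<in> C"
      have "(inv (\<phi> x) \<otimes> x) \<otimes> ((inv x \<otimes> y) \<otimes> inv (inv (\<phi> y) \<otimes> y)) \<in> ?C'"
        using \<phi> xy by (intro set_multI) auto
      moreover have "x \<in> carrier G" "y \<in> carrier G" "\<phi> x \<in> carrier G" "\<phi> y \<in> carrier G"
        using xy YQG \<phi> YG by auto
      ultimately show "inv (\<phi> x) \<otimes> \<phi> y \<in> ?C'"
        by (simp add: m_assoc inv_mult_group)
    next
      fix x y assume xy: "x \<in> Y i <#> Q" "y \<in> Y i <#> Q" "inv (\<phi> x) \<otimes> \<phi> y \<in> D"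
      have "inv (inv (\<phi> x) \<otimes> x) \<otimes> ((inv (\<phi> x) \<otimes> \<phi> y) \<otimes> (inv (\<phi> y) \<otimes> y)) \<in> ?D"
        using \<phi> xy by (intro set_multI) auto
      moreover have "x \<in> carrier G" "y \<in> carrier G" "\<phi> x \<in> carrier G" "\<phi> y \<in> carrier G"
        using xy YQG \<phi> YG by auto
      ultimately show "inv x \<otimes> y \<in> ?D"
        by (simp add: m_assoc inv_mult_group)
    qed (use \<phi> in auto)
  qed
  moreover have "compactin T ?D"
    using D Q by (intro compactin_set_mult compactin_m_inv)
  moreover have "X <#> Q = (\<Union>i\<le>n. Y i <#> Q)"
    using Y by (auto simp: set_mult_def)
  ultimately show "\<exists>D Y. compactin T D \<and> X <#> Q = (\<Union>i\<le>n. Y i) \<and> (\<forall>i\<le>n. comps_bounded (Y i) C D)"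
    by (intro exI[of _ ?D] exI[of _ "\<lambda>i. Y i <#> Q"]) auto
qed

text \<open>Kolmogorov's trick: after thickening the cover, the points that still have a single colour
  form the additional colour class.\<close>

lemma asdim_at_most_double_cover:
  assumes X: "asdim_at_most X n" "X \<subseteq> carrier G" and C0: "compactin T C0"
  shows "\<exists>D Y. compactin T D \<and> (\<forall>i\<le>Suc n. Y i \<subseteq> X \<and> comps_bounded (Y i) C0 D) \<and>
    (\<forall>x\<in>X. \<exists>i\<le>Suc n. \<exists>j\<le>Suc n. i \<noteq> j \<and> x \<in> Y i \<and> x \<in> Y j)"
proof -
  define C where "C = symmetrization C0"
  have C: "compactin T C" "\<one> \<in> C" "\<And>c. c \<in> C \<Longrightarrow> inv c \<in> C" "C \<subseteq> carrier G" "C0 \<subseteq> C"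
    unfolding C_def using C0 compactin_symmetrization compactin_subset_carrier inv_in_symmetrization
    by (auto simp: symmetrization_def)
  \<comment> \<open>Replacing both ends of a C-step between thickened sets by points of
    \<open>Y i\<close> costs one further factor C on each side.\<close>
  define C1 where "C1 = C <#> (C <#> C)"
  have "compactin T C1" using C by (auto simp: C1_def intro!: compactin_set_mult)
  then obtain D Y where D: "compactin T D" and Y: "X = (\<Union>i\<le>n. Y i)"
    and bd: "\<forall>i\<le>n. comps_bounded (Y i) C1 D"
    using X(1) by (auto simp: asdim_at_most_def)
  have "C \<subseteq> C1"
  proof
    fix c assume "c \<in> C"
    then have "c \<otimes> (\<one> \<otimes> \<one>) \<in> C1" unfolding C1_def using C by (intro set_multI)
    then show "c \<in> C1" using C \<open>c \<in> C\<close> by auto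
  qed
  define W where "W i = {x \<in> X. \<exists>y\<in>Y i. inv y \<otimes> x \<in> C}" for i
  define L where "L = {x \<in> X. \<exists>!i. i \<le> n \<and> x \<in> W i}"
  let ?D = "(C <#> (D <#> C)) \<union> D"
  have YW: "Y i \<subseteq> W i" if "i \<le> n" for i
  proof
    fix x assume "x \<in> Y i"
    moreover from this have "x \<in> X" "x \<in> carrier G" using Y that X by auto
    moreover from this have "inv x \<otimes> x \<in> C" using C(2) by simp
    ultimately show "x \<in> W i" unfolding W_def by blast
  qed
  have W: "comps_bounded (W i) C ?D" if i: "i \<le> n" for i
  proof -
    have "\<forall>x\<in>W i. \<exists>y. y \<in> Y i \<and> inv y \<otimes> x \<in> C" by (auto simp: W_def)
    then obtain \<phi> where \<phi>: "\<And>x. x \<in> W i \<Longrightarrow> \<phi> x \<in> Y i \<and> inv (\<phi> x) \<otimes> x \<in> C"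
      by metis
    have YG: "Y i \<subseteq> carrier G" "W i \<subseteq> carrier G" using i Y X by (auto simp: W_def)
    have sym: "inv x \<otimes> \<phi> x \<in> C" if "x \<in> W i" for x
    proof -
      have "inv (inv (\<phi> x) \<otimes> x) \<in> C" using \<phi> that C by blast
      then show ?thesis using \<phi>[OF that] YG that by (simp add: inv_mult_group subset_iff)
    qed
    show ?thesis
    proof (rule comps_bounded_map[where Y = "\<lambda>_::unit. Y i" and \<kappa> = "\<lambda>_. ()" and \<phi> = \<phi>])
      show "comps_bounded (Y i) C1 D" using bd i by auto
    next
      fix x y assume xy: "x \<in> W i" "y \<in> W i" "inv x \<otimes> y \<in> C"
      have "(inv (\<phi> x) \<otimes> x) \<otimes> ((inv x \<otimes> y) \<otimes> (inv y \<otimes> \<phi> y)) \<in> C1"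
        unfolding C1_def using \<phi> sym xy by (intro set_multI) auto
      moreover have "x \<in> carrier G" "y \<in> carrier G" "\<phi> x \<in> carrier G" "\<phi> y \<in> carrier G"
        using xy \<phi> YG by auto
      ultimately show "inv (\<phi> x) \<otimes> \<phi> y \<in> C1"
        by (simp add: m_assoc)
    next
      fix x y assume xy: "x \<in> W i" "y \<in> W i" "inv (\<phi> x) \<otimes> \<phi> y \<in> D"
      have "(inv x \<otimes> \<phi> x) \<otimes> ((inv (\<phi> x) \<otimes> \<phi> y) \<otimes> (inv (\<phi> y) \<otimes> y)) \<in> C <#> (D <#> C)"
        using \<phi> sym xy by (intro set_multI) auto
      moreover have "x \<in> carrier G" "y \<in> carrier G" "\<phi> x \<in> carrier G" "\<phi> y \<in> carrier G"
        using xy \<phi> YG by auto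
      ultimately show "inv x \<otimes> y \<in> ?D"
        by (simp add: m_assoc)
    qed (use \<phi> in auto)
  qed
  define \<kappa> where "\<kappa> x = (THE i. i \<le> n \<and> x \<in> W i)" for x
  have \<kappa>: "\<kappa> x \<le> n" "x \<in> W (\<kappa> x)" "x \<in> Y (\<kappa> x)" "\<And>i. i \<le> n \<Longrightarrow> x \<in> W i \<Longrightarrow> i = \<kappa> x"
    if x: "x \<in> L" for x
  proof -
    have ex1: "\<exists>!i. i \<le> n \<and> x \<in> W i" using x by (auto simp: L_def)
    then have *: "\<kappa> x \<le> n \<and> x \<in> W (\<kappa> x)" unfolding \<kappa>_def by (rule theI')
    then show "\<kappa> x \<le> n" "x \<in> W (\<kappa> x)" by auto
    show uniq: "\<And>i. i \<le> n \<Longrightarrow> x \<in> W i \<Longrightarrow> i = \<kappa> x" using * ex1 by blast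
    obtain i where "i \<le> n" "x \<in> Y i" using x Y by (auto simp: L_def)
    then show "x \<in> Y (\<kappa> x)" using uniq[of i] YW by auto
  qed
  have L: "comps_bounded L C ?D"
  proof (rule comps_bounded_map[where Y = Y and \<kappa> = \<kappa> and \<phi> = "\<lambda>x. x"])
    fix x assume "x \<in> L"
    then show "comps_bounded (Y (\<kappa> x)) C1 D" "x \<in> Y (\<kappa> x)" using bd \<kappa> by auto
  next
    fix x y assume xy: "x \<in> L" "y \<in> L" "inv x \<otimes> y \<in> C"
    \<comment> \<open>Since x lies in \<open>Y (\<kappa> x)\<close> itself, its C-neighbour y lies
      in the thickening of that colour, and y in L has no other colour. So colours never change
      along a C-chain in L.\<close>
    then have "y \<in> W (\<kappa> x)" using \<kappa>(3)[of x] by (auto simp: W_def L_def)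
    then show "\<kappa> x = \<kappa> y" using xy \<kappa> by blast
  qed (use \<open>C \<subseteq> C1\<close> in auto)
  let ?Y = "\<lambda>i. if i \<le> n then W i else L"
  show ?thesis
  proof (intro exI[of _ ?D] exI[of _ ?Y] conjI allI impI ballI)
    show "compactin T ?D" using C D by (intro compactin_Un compactin_set_mult)
    show "?Y i \<subseteq> X" for i by (auto simp: W_def L_def)
    show "comps_bounded (?Y i) C0 ?D" for i
      using W L C(5) by (auto intro: comps_bounded_mono)
    show "\<exists>i\<le>Suc n. \<exists>j\<le>Suc n. i \<noteq> j \<and> x \<in> ?Y i \<and> x \<in> ?Y j" if x: "x \<in> X" for x
    proof -
      obtain i where i: "i \<le> n" "x \<in> W i" using x Y YW by blast
      show ?thesis
      proof (cases "\<exists>j\<le>n. j \<noteq> i \<and> x \<in> W j")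
        case True
        then show ?thesis using i by (metis le_Suc_eq)
      next
        case False
        then have "x \<in> L" using i x by (auto simp: L_def)
        then show ?thesis using i by (intro exI[of _ i] conjI exI[of _ "Suc n"]) auto
      qed
    qed
  qed
qed

lemma asdim_at_most_one: "asdim_at_most {\<one>} 0"
proof -
  have "comps_bounded {\<one>} C {\<one>}" for C
    unfolding comps_bounded_def using chain_in_set[of \<one> _ "{\<one>}" C]
    by (metis insertI1 inv_one l_one one_closed singletonD)
  moreover have "compactin T {\<one>}" by (rule compactin_finite) auto
  ultimately show ?thesis
    unfolding asdim_at_most_def
    by (intro allI impI exI[of _ "{\<one>}"] exI[of _ "\<lambda>_. {\<one>}"]) auto
qed

text \<open>The cosets of \<open>L\<close> are invariant under \<open>C\<close>-chains, and each is a translate of \<open>L\<close>.\<close>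

lemma asdim_at_most_locally_elliptic:
  assumes H: "asdim_at_most H n" "H \<subseteq> carrier G" and K: "subgroup K G"
    and le: "\<And>C. compactin T C \<Longrightarrow>
        \<exists>L Q. subgroup L G \<and> L \<subseteq> K \<and> C \<inter> K \<subseteq> L \<and> compactin T Q \<and> L \<subseteq> H <#> Q"
  shows "asdim_at_most K n"
  unfolding asdim_at_most_def
proof (intro allI impI)
  fix C assume C: "compactin T C"
  obtain L Q where L: "subgroup L G" "L \<subseteq> K" "C \<inter> K \<subseteq> L" "compactin T Q" "L \<subseteq> H <#> Q"
    using le[OF C] by blast
  have "asdim_at_most L n"
    using asdim_at_most_subset[OF asdim_at_most_set_mult] H L by blast
  then obtain D Y where D: "compactin T D" and Y: "L = (\<Union>i\<le>n. Y i)"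
    and bd: "\<forall>i\<le>n. comps_bounded (Y i) C D"
    using C by (auto simp: asdim_at_most_def)
  have KG: "K \<subseteq> carrier G" using K subgroup.subset by blast
  \<comment> \<open>The choice sees only the coset \<open>x <# L\<close>, so \<rho> is constant on
    cosets. It serves both as the label and as the element translating the coset back to L.\<close>
  define \<rho> where "\<rho> x = (SOME z. z \<in> x <# L)" for x
  have \<rho>: "\<rho> x \<in> x <# L" if "x \<in> K" for x
  proof -
    have "x \<otimes> \<one> \<in> x <# L" using L(1) subgroup.one_closed by (force simp: l_coset_def)
    then show ?thesis unfolding \<rho>_def by (rule someI)
  qed
  have \<rho>K: "\<rho> x \<in> K" "inv (\<rho> x) \<otimes> x \<in> L" "\<rho> x \<in> carrier G" if x: "x \<in> K" for x
  proof -
    obtain l where l: "l \<in> L" "\<rho> x = x \<otimes> l" using \<rho>[OF x] by (auto simp: l_coset_def)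
    then show "\<rho> x \<in> K" using x L K by (auto intro: subgroup.m_closed)
    then show "\<rho> x \<in> carrier G" using KG by auto
    have "l \<in> carrier G" "x \<in> carrier G" using l x L KG by auto
    then show "inv (\<rho> x) \<otimes> x \<in> L"
      using l L(1) by (simp add: inv_mult_group m_assoc subgroup.m_inv_closed)
  qed
  define Z where "Z i = {x \<in> K. inv (\<rho> x) \<otimes> x \<in> Y i}" for i
  have "comps_bounded (Z i) C D" if i: "i \<le> n" for i
  proof (rule comps_bounded_map[where Y = "\<lambda>_. Y i" and \<kappa> = \<rho> and \<phi> = "\<lambda>x. inv (\<rho> x) \<otimes> x"])
    show "comps_bounded (Y i) C D" using bd i by auto
  next
    fix x y assume xy: "x \<in> Z i" "y \<in> Z i" "inv x \<otimes> y \<in> C"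
    have K': "x \<in> K" "y \<in> K" "x \<in> carrier G" "y \<in> carrier G" using xy KG by (auto simp: Z_def)
    then have "inv x \<otimes> y \<in> K" using K by (simp add: subgroup.m_closed subgroup.m_inv_closed)
    then have "inv x \<otimes> y \<in> L" using xy L by auto
    then have "x \<otimes> (inv x \<otimes> y) \<in> x <# L" unfolding l_coset_def by blast
    then have "y \<in> x <# L" using K' by simp
    then have "x <# L = y <# L"
      using l_repr_independence L(1) K' by blast
    then show "\<rho> x = \<rho> y" by (simp add: \<rho>_def)
  next
    fix x y assume xy: "x \<in> Z i" "y \<in> Z i" "\<rho> x = \<rho> y"
    then have G: "x \<in> carrier G" "y \<in> carrier G" "\<rho> y \<in> carrier G"
      using KG \<rho>K by (auto simp: Z_def)
    have eq: "inv (inv (\<rho> x) \<otimes> x) \<otimes> (inv (\<rho> y) \<otimes> y) = inv x \<otimes> y"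
      using xy G by (simp add: inv_mult_group m_assoc)
    { assume "inv x \<otimes> y \<in> C"
      then show "inv (inv (\<rho> x) \<otimes> x) \<otimes> (inv (\<rho> y) \<otimes> y) \<in> C" by (simp add: eq) }
    { assume "inv (inv (\<rho> x) \<otimes> x) \<otimes> (inv (\<rho> y) \<otimes> y) \<in> D"
      then show "inv x \<otimes> y \<in> D" by (simp add: eq) }
  qed (auto simp: Z_def)
  moreover have "K = (\<Union>i\<le>n. Z i)"
    using \<rho>K(2) Y by (auto simp: Z_def)
  ultimately show "\<exists>D Y. compactin T D \<and> K = (\<Union>i\<le>n. Y i) \<and> (\<forall>i\<le>n. comps_bounded (Y i) C D)"
    using D by blast
qed

section \<open>Extensions by the integers\<close>

context
  fixes K :: "'a set" and \<pi> :: "'a \<Rightarrow> int" and g :: 'a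
  assumes K: "subgroup K G"
    and \<pi>_mult: "\<And>x y. x \<in> K \<Longrightarrow> y \<in> K \<Longrightarrow> \<pi> (x \<otimes> y) = \<pi> x + \<pi> y"
    and g: "g \<in> K" "\<pi> g = 1"
begin

lemma int_hom_inv: "x \<in> K \<Longrightarrow> \<pi> (inv x) = - \<pi> x"
proof -
  assume x: "x \<in> K"
  have "\<pi> (\<one> \<otimes> \<one>) = \<pi> \<one> + \<pi> \<one>" using \<pi>_mult subgroup.one_closed[OF K] by blast
  then have "\<pi> \<one> = 0" by simp
  moreover have "\<pi> (x \<otimes> inv x) = \<pi> x + \<pi> (inv x)"
    using \<pi>_mult[OF x subgroup.m_inv_closed[OF K x]] .
  moreover have "x \<in> carrier G" using K x subgroup.mem_carrier by fast
  ultimately show ?thesis by simp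
qed

lemma int_hom_pow_closed: "g [^] (m::int) \<in> K"
  using K g subgroup_int_pow_closed by blast

lemma int_hom_pow: "\<pi> (g [^] (m::int)) = m"
proof -
  have gG: "g \<in> carrier G" using K g subgroup.mem_carrier by fast
  have 0: "\<pi> \<one> = 0" using \<pi>_mult[of \<one> \<one>] K subgroup.one_closed by fastforce
  have nat: "\<pi> (g [^] int k) = int k" for k
  proof (induction k)
    case (Suc k)
    have "g [^] int (Suc k) = g [^] int k \<otimes> g"
      using gG int_pow_mult[of g "int k" 1] by (simp add: add.commute)
    then show ?case using Suc \<pi>_mult[OF int_hom_pow_closed g(1)] g by simp
  qed (simp add: 0)
  show ?thesis
  proof (cases "m \<ge> 0")
    case True
    then show ?thesis using nat[of "nat m"] by simp
  next
    case False
    have "\<pi> (g [^] (- (- m))) = - \<pi> (g [^] (-m))"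
      using int_pow_neg[OF gG, of "-m"] int_hom_inv[OF int_hom_pow_closed] by simp
    then show ?thesis using False nat[of "nat (-m)"] by simp
  qed
qed

text \<open>Each x is an element of the kernel times \<open>g [^] \<pi> x\<close>, and only finitely
  many exponents occur in a strip, so the strip is a compact thickening of part of the
  kernel.\<close>

lemma asdim_at_most_strip:
  assumes "asdim_at_most {x \<in> K. \<pi> x = 0} n"
  shows "asdim_at_most {x \<in> K. a \<le> \<pi> x \<and> \<pi> x < b} n"
proof (rule asdim_at_most_subset[OF asdim_at_most_set_mult[OF assms]])
  let ?Q = "(\<lambda>m::int. g [^] m) ` {a..<b}"
  have KG: "K \<subseteq> carrier G" using K subgroup.subset by blast
  then show "{x \<in> K. \<pi> x = 0} \<subseteq> carrier G" by auto
  show "compactin T ?Q" using int_hom_pow_closed KG by (intro compactin_finite) auto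
  show "{x \<in> K. a \<le> \<pi> x \<and> \<pi> x < b} \<subseteq> {x \<in> K. \<pi> x = 0} <#> ?Q"
  proof
    fix x assume x: "x \<in> {x \<in> K. a \<le> \<pi> x \<and> \<pi> x < b}"
    let ?y = "x \<otimes> inv (g [^] \<pi> x)"
    have "inv (g [^] \<pi> x) \<in> K" by (rule subgroup.m_inv_closed[OF K int_hom_pow_closed])
    then have "?y \<in> K" "\<pi> ?y = 0"
      using x \<pi>_mult int_hom_inv[OF int_hom_pow_closed] int_hom_pow subgroup.m_closed[OF K] by auto
    moreover have "g [^] \<pi> x \<in> ?Q" using x by auto
    ultimately have "?y \<otimes> g [^] \<pi> x \<in> {x \<in> K. \<pi> x = 0} <#> ?Q" by (intro set_multI) auto
    moreover have "x \<in> carrier G" "g [^] \<pi> x \<in> carrier G" using x KG int_hom_pow_closed by auto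
    ultimately show "x \<in> {x \<in> K. \<pi> x = 0} <#> ?Q" by (simp add: m_assoc)
  qed
qed

text \<open>The group is cut along \<open>\<pi>\<close> into alternating walls and strips. A wall carries a cover with
  \<open>n + 2\<close> colours hitting every point twice, so that the \<open>i\<close>-th colour may be interrupted at its own
  level \<open>[i r, (i + 1) r)\<close> of the wall; the strips carry a cover with \<open>n + 1\<close> colours at a scale that
  is large compared to the cover of the walls, and the two can be merged colour by colour.\<close>

lemma asdim_at_most_int_extension:
  assumes ker: "asdim_at_most {x \<in> K. \<pi> x = 0} n"
    and \<pi>_bounded: "\<And>C. compactin T C \<Longrightarrow> \<exists>r. \<forall>c\<in>C \<inter> K. \<bar>\<pi> c\<bar> < r"
  shows "asdim_at_most K (Suc n)"
  unfolding asdim_at_most_def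
proof (intro allI impI)
  fix C0 assume C0: "compactin T C0"
  define C where "C = symmetrization C0"
  have C: "compactin T C" "\<one> \<in> C" "\<And>c. c \<in> C \<Longrightarrow> inv c \<in> C" "C \<subseteq> carrier G" "C0 \<subseteq> C"
    unfolding C_def using C0 compactin_symmetrization compactin_subset_carrier inv_in_symmetrization
    by (auto simp: symmetrization_def)
  have KG: "K \<subseteq> carrier G" using K subgroup.subset by blast
  have gG: "g \<in> carrier G" using g KG by auto
  obtain r0 where r0: "\<forall>c\<in>C \<inter> K. \<bar>\<pi> c\<bar> < r0" using \<pi>_bounded[OF C(1)] by blast
  define r where "r = max 1 r0"
  have r: "r > 0" "\<And>c. c \<in> C \<Longrightarrow> c \<in> K \<Longrightarrow> \<bar>\<pi> c\<bar> < r"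
    using r0 by (force simp: r_def)+
  have \<pi>_step: "\<bar>\<pi> y - \<pi> x\<bar> < r" if "x \<in> K" "y \<in> K" "inv x \<otimes> y \<in> C" for x y
  proof -
    have "inv x \<in> K" "inv x \<otimes> y \<in> K"
      using that K by (auto simp: subgroup.m_closed subgroup.m_inv_closed)
    then show ?thesis using r(2)[of "inv x \<otimes> y"] \<pi>_mult[of "inv x" y] int_hom_inv[of x] that by simp
  qed
  \<comment> \<open>The wall has n + 2 levels of height r, one per colour. A strip of height r
    separates it from the next wall, so no C-step inside K jumps over a strip. M is the resulting
    period.\<close>
  define w where "w = (int n + 2) * r"
  define M where "M = w + r"
  have wM: "w > 0" "M > 0" "w < M" using r by (auto simp: w_def M_def intro: add_pos_pos)
  have ir: "int i * r + r \<le> w" if "i \<le> Suc n" for i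
  proof -
    have "(int i + 1) * r \<le> (int n + 2) * r" using that r by (intro mult_right_mono) auto
    then show ?thesis by (simp add: w_def algebra_simps)
  qed
  have ir0: "0 \<le> int i * r" for i using r by simp

  let ?W = "{x \<in> K. 0 \<le> \<pi> x \<and> \<pi> x < w}" and ?S = "{x \<in> K. w \<le> \<pi> x \<and> \<pi> x < M}"
  have WG: "?W \<subseteq> carrier G" using KG by auto
  obtain D0' V where D0': "compactin T D0'"
    and V': "\<forall>i\<le>Suc n. V i \<subseteq> ?W \<and> comps_bounded (V i) C D0'"
    and V3: "\<forall>x\<in>?W. \<exists>i\<le>Suc n. \<exists>j\<le>Suc n. i \<noteq> j \<and> x \<in> V i \<and> x \<in> V j"
    using asdim_at_most_double_cover[OF asdim_at_most_strip[OF ker, of 0 w] WG C(1)] by (elim exE conjE)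
  have V: "V i \<subseteq> ?W" "comps_bounded (V i) C D0'" if "i \<le> Suc n" for i
    using V' that by blast+
  \<comment> \<open>The identity accounts for chains that end in U without an excursion into V, and
    gives \<open>C \<subseteq> C1\<close> in the saturated union.\<close>
  define D0 where "D0 = insert \<one> D0'"
  have D0: "compactin T D0" "\<one> \<in> D0" "D0' \<subseteq> D0"
    using compactin_Un[OF compactin_finite[of "{\<one>}"] D0'] by (auto simp: D0_def)
  define C1 where "C1 = C <#> (D0 <#> C)"
  have C1: "compactin T C1" using C D0 by (auto simp: C1_def intro!: compactin_set_mult)
  obtain D1 U' where D1: "compactin T D1" and U'S: "?S = (\<Union>i\<le>n. U' i)"
    and U'b: "\<forall>i\<le>n. comps_bounded (U' i) C1 D1"
    using asdim_at_most_strip[OF ker, of w M] C1 unfolding asdim_at_most_def by blast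
  \<comment> \<open>The strips need only n + 1 colours; the last colour is empty there.\<close>
  define U where "U i = (if i \<le> n then U' i else {})" for i
  have U: "U i \<subseteq> ?S" "comps_bounded (U i) C1 D1" for i
    using U'S U'b by (auto simp: U_def comps_bounded_def)

  define s where "s = g [^] M"
  have s: "s \<in> K" "\<pi> s = M" "s \<in> carrier G"
    using int_hom_pow_closed int_hom_pow KG by (auto simp: s_def)
  \<comment> \<open>A cell of colour i starts above level i of one wall, crosses the strip and ends
    below level i of the next wall. It therefore meets the wall cover and its translate by one
    period.\<close>
  define V2 where "V2 i = V i \<union> (\<lambda>x. s \<otimes> x) ` V i" for i
  have V2: "comps_bounded (V2 i) C D0" if i: "i \<le> Suc n" for i
  proof -
    have VK: "V i \<subseteq> K" "V i \<subseteq> carrier G" "\<And>x. x \<in> V i \<Longrightarrow> 0 \<le> \<pi> x \<and> \<pi> x < w"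
      using V(1)[OF i] KG by auto
    have V2K: "V2 i \<subseteq> K" using VK s K by (auto simp: V2_def intro: subgroup.m_closed)
    have cases: "x \<in> V i \<and> \<pi> x < w \<or> (\<exists>y\<in>V i. x = s \<otimes> y \<and> M \<le> \<pi> x)" if "x \<in> V2 i" for x
      using that VK s \<pi>_mult by (auto simp: V2_def)
    show ?thesis
    proof (rule comps_bounded_map[where Y = "\<lambda>_. V i" and \<kappa> = "\<lambda>x. M \<le> \<pi> x"
          and \<phi> = "\<lambda>x. if M \<le> \<pi> x then inv s \<otimes> x else x"])
      show "comps_bounded (V i) C D0" using V(2)[OF i] D0 by (auto intro: comps_bounded_mono)
    next
      fix x assume "x \<in> V2 i"
      from cases[OF this] show "(if M \<le> \<pi> x then inv s \<otimes> x else x) \<in> V i"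
        using wM VK s by auto
    next
      fix x y assume xy: "x \<in> V2 i" "y \<in> V2 i" "inv x \<otimes> y \<in> C"
      then have "\<bar>\<pi> y - \<pi> x\<bar> < r" using \<pi>_step V2K by blast
      \<comment> \<open>The heights of the two walls are separated by a gap of r, so a C-step cannot
        lead from one wall to the other.\<close>
      then show "(M \<le> \<pi> x) = (M \<le> \<pi> y)"
        using cases[OF xy(1)] cases[OF xy(2)] by (auto simp: M_def)
    next
      fix x y assume xy: "x \<in> V2 i" "y \<in> V2 i" "(M \<le> \<pi> x) = (M \<le> \<pi> y)"
      have G: "x \<in> carrier G" "y \<in> carrier G" using xy V2K KG by auto
      have eq: "inv (if M \<le> \<pi> x then inv s \<otimes> x else x) \<otimes> (if M \<le> \<pi> y then inv s \<otimes> y else y)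
          = inv x \<otimes> y"
        using xy G s by (simp add: inv_mult_group m_assoc)
      { assume "inv x \<otimes> y \<in> C"
        then show "inv (if M \<le> \<pi> x then inv s \<otimes> x else x)
            \<otimes> (if M \<le> \<pi> y then inv s \<otimes> y else y) \<in> C" by (simp only: eq) }
      { assume "inv (if M \<le> \<pi> x then inv s \<otimes> x else x)
            \<otimes> (if M \<le> \<pi> y then inv s \<otimes> y else y) \<in> D0"
        then show "inv x \<otimes> y \<in> D0" by (simp only: eq) }
    qed
  qed
  define E where "E = D1 <#> (C <#> D0)"
  define D where "D = D0 \<union> (m_inv G ` E <#> E)"
  have E: "compactin T E" using D1 C D0 by (auto simp: E_def intro!: compactin_set_mult)
  then have D: "compactin T D"
    using D0 by (auto simp: D_def intro!: compactin_Un compactin_set_mult compactin_m_inv)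
  have UV2: "comps_bounded (U i \<union> V2 i) C D" if i: "i \<le> Suc n" for i
  proof (rule comps_bounded_saturated_Un[where ?D0.0 = D0 and ?D1.0 = D1 and ?C1.0 = C1 and E = E])
    show "U i \<subseteq> carrier G" using U KG by blast
    show "C \<subseteq> carrier G" "D0 \<subseteq> carrier G" "D1 \<subseteq> carrier G" "D \<subseteq> carrier G" "E \<subseteq> carrier G"
      using C(1) D0(1) D1 D E compactin_subset_carrier by simp_all
    show "comps_bounded (U i) C1 D1" "comps_bounded (V2 i) C D0" by (rule U V2[OF i])+
    show "C <#> (D0 <#> C) \<subseteq> C1" "D0 \<subseteq> D" "D1 <#> (C <#> D0) \<subseteq> E" "m_inv G ` E <#> E \<subseteq> D"
      by (simp_all add: C1_def E_def D_def)
    show "V2 i \<subseteq> carrier G" using V(1)[OF i] KG s by (auto simp: V2_def subset_iff)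
  qed (use C(2,3) D0(2) in auto)

  \<comment> \<open>Left multiplication by g to a multiple of the period brings x to a height
    between 0 and M.\<close>
  define x0 where "x0 x = g [^] (- (\<pi> x div M * M)) \<otimes> x" for x
  have x0: "x0 x \<in> K" "\<pi> (x0 x) = \<pi> x mod M" if "x \<in> K" for x
    using subgroup.m_closed[OF K int_hom_pow_closed that] \<pi>_mult[OF int_hom_pow_closed that]
    by (simp_all add: x0_def int_hom_pow minus_div_mult_eq_mod[symmetric])
  define Z where "Z i = {x \<in> K. x0 x \<in> U i \<or>
      x0 x \<in> V i \<and> \<not> (int i * r \<le> \<pi> x mod M \<and> \<pi> x mod M < int i * r + r)}" for i
  have cover: "K = (\<Union>i\<le>Suc n. Z i)"
  proof (intro equalityI subsetI)
    fix x assume x: "x \<in> K"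
    have p: "0 \<le> \<pi> x mod M" "\<pi> x mod M < M" using wM by auto
    show "x \<in> (\<Union>i\<le>Suc n. Z i)"
    proof (cases "\<pi> x mod M < w")
      case True
      then have "x0 x \<in> ?W" using x0[OF x] p by simp
      from bspec[OF V3 this] obtain i j where ij: "i \<le> Suc n" "j \<le> Suc n" "i \<noteq> j"
          "x0 x \<in> V i" "x0 x \<in> V j" by blast
      \<comment> \<open>A point lies on at most one level, so at most one of its two wall colours i
        and j is interrupted there and the other one still covers it.\<close>
      have level: "\<pi> x mod M div r = int k" if "int k * r \<le> \<pi> x mod M" "\<pi> x mod M < int k * r + r" for k
        by (rule int_div_pos_eq[where r = "\<pi> x mod M - int k * r"]) (use that in auto)
      have "x \<in> Z i \<or> x \<in> Z j" using ij x level[of i] level[of j] by (auto simp: Z_def)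
      then show ?thesis using ij(1,2) by auto
    next
      case False
      then have "x0 x \<in> ?S" using x0[OF x] p by simp
      then obtain i where "i \<le> n" "x0 x \<in> U' i" using U'S by blast
      then have "x \<in> Z i" using x by (auto simp: Z_def U_def)
      then show ?thesis using \<open>i \<le> n\<close> by auto
    qed
  qed (auto simp: Z_def)
  have ZD: "comps_bounded (Z i) C D" if i: "i \<le> Suc n" for i
  proof -
    \<comment> \<open>Cells of colour i are offset by \<open>int i * r\<close>, so that each begins
      with the interrupted level. \<kappa> is the index of the cell and \<phi> shifts that cell to
      index 0.\<close>
    define \<kappa> where "\<kappa> x = (\<pi> x - int i * r) div M" for x
    define \<phi> where "\<phi> x = g [^] (- (\<kappa> x * M)) \<otimes> x" for x
    \<comment> \<open>The lowest r units of height in every cell contain no point of colour i. This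
      is what keeps a C-step from changing the cell.\<close>
    have cell: "\<kappa> x * M + r \<le> \<pi> x - int i * r \<and> \<pi> x - int i * r < \<kappa> x * M + M \<and> \<phi> x \<in> U i \<union> V2 i"
      if x: "x \<in> Z i" for x
    proof -
      have xK: "x \<in> K" "x \<in> carrier G" using x KG by (auto simp: Z_def)
      define p where "p = \<pi> x mod M"
      define j where "j = \<pi> x div M"
      have p: "\<pi> x = j * M + p" "0 \<le> p" "p < M" using wM by (auto simp: p_def j_def)
      show ?thesis
      proof (cases "int i * r \<le> p")
        case True
        have "\<kappa> x = j" unfolding \<kappa>_def
        proof (rule int_div_pos_eq[where r = "p - int i * r"])
          show "\<pi> x - int i * r = M * j + (p - int i * r)"
            using p(1) by (simp add: mult.commute)
        qed (use p True ir0[of i] in linarith)+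
        then have "\<phi> x = x0 x" by (simp add: \<phi>_def x0_def j_def)
        moreover have "int i * r + r \<le> p"
        proof (cases "x0 x \<in> U i")
          case True
          then have "w \<le> p" using U(1)[of i] x0(2)[OF xK(1)] by (auto simp: p_def)
          then show ?thesis using ir[OF i] by simp
        next
          case False
          then show ?thesis using x True by (auto simp: Z_def p_def)
        qed
        ultimately show ?thesis using x p \<open>\<kappa> x = j\<close> ir0[of i] by (auto simp: Z_def V2_def)
      next
        case False
        then have "x0 x \<notin> U i" using U(1)[of i] x0(2)[OF xK(1)] ir[OF i] r by (auto simp: p_def)
        then have "x0 x \<in> V i" using x by (auto simp: Z_def)
        \<comment> \<open>Below level i of its wall, x belongs to the cell that began one period
          earlier; \<phi> therefore puts it in the upper wall, the translate by s.\<close>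
        have \<kappa>: "\<kappa> x = j - 1" unfolding \<kappa>_def
        proof (rule int_div_pos_eq[where r = "p - int i * r + M"])
          show "\<pi> x - int i * r = M * (j - 1) + (p - int i * r + M)"
            using p(1) by (simp add: right_diff_distrib mult.commute)
        qed (use p False ir[OF i] wM r(1) in linarith)+
        have "- (\<kappa> x * M) = M + - (j * M)" by (simp add: \<kappa> algebra_simps)
        then have "g [^] (- (\<kappa> x * M)) = s \<otimes> g [^] (- (j * M))"
          by (simp only: int_pow_mult[OF gG] s_def)
        then have "\<phi> x = s \<otimes> x0 x"
          using gG xK s(3) by (simp add: \<phi>_def x0_def j_def m_assoc)
        then have "\<phi> x \<in> V2 i" using \<open>x0 x \<in> V i\<close> by (auto simp: V2_def)
        moreover have "\<kappa> x * M = j * M - M" by (simp add: \<kappa> algebra_simps)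
        moreover have "\<kappa> x * M + r \<le> \<pi> x - int i * r" "\<pi> x - int i * r < \<kappa> x * M + M"
          using calculation(2) p(1,2) False ir[OF i] wM(3) by linarith+
        ultimately show ?thesis by blast
      qed
    qed
    have ZG: "Z i \<subseteq> K" by (auto simp: Z_def)
    have \<kappa>le: "\<not> \<kappa> x < \<kappa> y" if "x \<in> Z i" "y \<in> Z i" "\<bar>\<pi> y - \<pi> x\<bar> < r" for x y
    proof
      assume "\<kappa> x < \<kappa> y"
      then have "(\<kappa> x + 1) * M \<le> \<kappa> y * M" using wM by (intro mult_right_mono) auto
      then have "\<kappa> x * M + M \<le> \<kappa> y * M" by (simp add: distrib_right)
      then show False using cell[OF that(1)] cell[OF that(2)] that(3) by linarith
    qed
    show ?thesis
    proof (rule comps_bounded_map[where Y = "\<lambda>_. U i \<union> V2 i" and \<kappa> = \<kappa> and \<phi> = \<phi>])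
      show "comps_bounded (U i \<union> V2 i) C D" by (rule UV2[OF i])
      show "\<phi> x \<in> U i \<union> V2 i" if "x \<in> Z i" for x using cell[OF that] by blast
    next
      fix x y assume xy: "x \<in> Z i" "y \<in> Z i" "inv x \<otimes> y \<in> C"
      then have "\<bar>\<pi> y - \<pi> x\<bar> < r" using \<pi>_step ZG by blast
      then show "\<kappa> x = \<kappa> y" using \<kappa>le[OF xy(1,2)] \<kappa>le[OF xy(2,1)] by (simp add: abs_minus_commute)
    next
      fix x y assume xy: "x \<in> Z i" "y \<in> Z i" "\<kappa> x = \<kappa> y"
      have G: "x \<in> carrier G" "y \<in> carrier G" using xy ZG KG by auto
      have eq: "inv (\<phi> x) \<otimes> \<phi> y = inv x \<otimes> y"
        using xy G gG by (simp add: \<phi>_def inv_mult_group m_assoc)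
      { assume "inv x \<otimes> y \<in> C" then show "inv (\<phi> x) \<otimes> \<phi> y \<in> C" by (simp only: eq) }
      { assume "inv (\<phi> x) \<otimes> \<phi> y \<in> D" then show "inv x \<otimes> y \<in> D" by (simp only: eq) }
    qed
  qed
  have "comps_bounded (Z i) C0 D" if "i \<le> Suc n" for i
    by (rule comps_bounded_mono[OF ZD[OF that] subset_refl C(5) subset_refl])
  then show "\<exists>D Y. compactin T D \<and> K = (\<Union>i\<le>Suc n. Y i) \<and> (\<forall>i\<le>Suc n. comps_bounded (Y i) C0 D)"
    using D cover by (intro exI[of _ D] exI[of _ Z] conjI) simp_all
qed

end

subsection \<open>Neighbourhoods of the identity\<close>

lemma openin_r_translate:
  assumes "openin T V" "c \<in> carrier G"
  shows "openin T (V #> c)"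
proof -
  have "continuous_map T (prod_topology T T) (\<lambda>x. (x, inv c))"
    using assms by (intro continuous_map_pairedI) (auto simp: topspace_eq_carrier)
  from continuous_map_compose[OF this continuous_mult]
  have "continuous_map T T (\<lambda>x. x \<otimes> inv c)" by (simp add: o_def)
  then have "openin T {x \<in> topspace T. x \<otimes> inv c \<in> V}"
    using assms(1) by (rule openin_continuous_map_preimage)
  moreover have "{x \<in> topspace T. x \<otimes> inv c \<in> V} = V #> c"
  proof (intro equalityI subsetI)
    fix x assume "x \<in> {x \<in> topspace T. x \<otimes> inv c \<in> V}"
    then have x: "x \<in> carrier G" "x \<otimes> inv c \<in> V" by (auto simp: topspace_eq_carrier)
    moreover have "x = x \<otimes> inv c \<otimes> c" using x assms by (simp add: m_assoc)
    ultimately show "x \<in> V #> c" unfolding r_coset_def by blast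
  next
    fix x assume "x \<in> V #> c"
    then obtain v where "v \<in> V" "x = v \<otimes> c" by (auto simp: r_coset_def)
    moreover have "V \<subseteq> carrier G" using assms openin_subset topspace_eq_carrier by metis
    ultimately show "x \<in> {x \<in> topspace T. x \<otimes> inv c \<in> V}"
      using assms by (auto simp: topspace_eq_carrier m_assoc subset_iff)
  qed
  ultimately show ?thesis by simp
qed

lemma finite_translate_cover:
  assumes C: "compactin T C" and V: "openin T V" "\<one> \<in> V"
  obtains F where "finite F" "F \<subseteq> C" "C \<subseteq> (\<Union>c\<in>F. V #> c)"
proof -
  have CG: "C \<subseteq> carrier G" using C compactin_subset_carrier by blast
  have "C \<subseteq> \<Union>((\<lambda>c. V #> c) ` C)"
  proof
    fix c assume c: "c \<in> C"
    have "\<one> \<otimes> c \<in> V #> c" using V unfolding r_coset_def by blast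
    moreover have "\<one> \<otimes> c = c" using c CG by auto
    ultimately show "c \<in> \<Union>((\<lambda>c. V #> c) ` C)" using c by auto
  qed
  moreover have "openin T U" if "U \<in> (\<lambda>c. V #> c) ` C" for U
    using that openin_r_translate[OF V(1)] CG by auto
  ultimately obtain \<F> where \<F>: "finite \<F>" "\<F> \<subseteq> (\<lambda>c. V #> c) ` C" "C \<subseteq> \<Union>\<F>"
    using compactinD[OF C, of "(\<lambda>c. V #> c) ` C"] by auto
  obtain F where "F \<subseteq> C" "finite F" "\<F> = (\<lambda>c. V #> c) ` F"
    using finite_subset_image[OF \<F>(1,2)] by blast
  then show thesis using that \<F> by blast
qed

lemma small_neighbourhood:
  assumes U: "openin T U" "\<one> \<in> U"
  obtains V where "openin T V" "\<one> \<in> V" "\<And>x y. x \<in> V \<Longrightarrow> y \<in> V \<Longrightarrow> x \<otimes> inv y \<in> U"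
proof -
  have "continuous_map (prod_topology T T) (prod_topology T T) (\<lambda>p. (fst p, inv (snd p)))"
    using continuous_map_compose[OF continuous_map_snd continuous_inv]
    by (intro continuous_map_pairedI continuous_map_fst) (simp add: o_def)
  from continuous_map_compose[OF this continuous_mult]
  have "continuous_map (prod_topology T T) T (\<lambda>p. fst p \<otimes> inv (snd p))" by (simp add: o_def)
  note openin_continuous_map_preimage[OF this U(1)]
  moreover define P where "P = {p \<in> topspace (prod_topology T T). fst p \<otimes> inv (snd p) \<in> U}"
  ultimately have "openin (prod_topology T T) P" by simp
  moreover have "(\<one>, \<one>) \<in> P" using U by (auto simp: P_def topspace_eq_carrier)
  ultimately have "\<exists>A B. openin T A \<and> openin T B \<and> \<one> \<in> A \<and> \<one> \<in> B \<and> A \<times> B \<subseteq> P"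
    by (simp add: openin_prod_topology_alt)
  then obtain A B where AB: "openin T A" "openin T B" "\<one> \<in> A" "\<one> \<in> B" "A \<times> B \<subseteq> P" by blast
  have P: "x \<otimes> inv y \<in> U" if "x \<in> A" "y \<in> B" for x y using AB(5) that by (auto simp: P_def)
  show thesis
    by (rule that[of "A \<inter> B"]) (use AB P in auto)
qed

lemma relatively_compact_neighbourhood:
  assumes "x \<in> carrier G"
  obtains V C where "openin T V" "x \<in> V" "V \<subseteq> C" "compactin T C"
proof -
  have "\<exists>V C. openin T V \<and> compactin T C \<and> x \<in> V \<and> V \<subseteq> C"
    using assms locally_compact by (simp add: locally_compact_space_def topspace_eq_carrier)
  then show thesis using that by blast
qed

subsection \<open>Cyclic subgroups of abelian sections\<close>

text \<open>The commutator condition says that K/H is abelian and, as H lies in K, also that H is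
  normal in K. In this form it passes to intermediate subgroups and, by continuity of commutators,
  to closures.\<close>

definition abelian_section :: "'a set \<Rightarrow> 'a set \<Rightarrow> bool" where
  "abelian_section H K \<longleftrightarrow> subgroup H G \<and> subgroup K G \<and> H \<subseteq> K \<and>
     (\<forall>x\<in>K. \<forall>y\<in>K. x \<otimes> y \<otimes> inv x \<otimes> inv y \<in> H)"

lemma abelian_section_mono:
  assumes "abelian_section H K" "subgroup L G" "H \<subseteq> L" "L \<subseteq> K"
  shows "abelian_section L K"
  using assms by (auto simp: abelian_section_def)

lemma abelian_section_conj:
  assumes "abelian_section H K" "x \<in> K" "h \<in> H"
  shows "x \<otimes> h \<otimes> inv x \<in> H"
proof -
  have sub: "subgroup H G" "subgroup K G" and hK: "h \<in> K" and H: "x \<otimes> h \<otimes> inv x \<otimes> inv h \<in> H"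
    using assms by (auto simp: abelian_section_def)
  have "x \<otimes> h \<otimes> inv x \<otimes> inv h \<otimes> h \<in> H"
    by (intro subgroup.m_closed[OF sub(1) H assms(3)])
  moreover have "x \<in> carrier G" "h \<in> carrier G"
    using sub assms(2) hK by (auto simp: subgroup.mem_carrier)
  ultimately show ?thesis by (simp add: m_assoc)
qed

lemma abelian_section_subset:
  assumes "abelian_section H K" shows "H \<subseteq> carrier G" "K \<subseteq> carrier G"
  using assms by (auto simp: abelian_section_def subgroup.mem_carrier)

lemma subgroup_adjoin:
  assumes S: "abelian_section H K" and g: "g \<in> K"
  defines "L \<equiv> H <#> range (\<lambda>m::int. g [^] m)"
  shows "subgroup L G" "H \<subseteq> L" "g \<in> L" "L \<subseteq> K"
proof -
  have sub: "subgroup H G" "subgroup K G" "H \<subseteq> K" using S by (auto simp: abelian_section_def)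
  have G: "H \<subseteq> carrier G" "K \<subseteq> carrier G" using abelian_section_subset[OF S] by auto
  have gG: "g \<in> carrier G" using g G by auto
  have gm: "g [^] (m::int) \<in> K" for m using subgroup_int_pow_closed[OF sub(2) g] .
  have LI: "h \<otimes> g [^] (m::int) \<in> L" if "h \<in> H" for h m
    unfolding L_def using that by (intro set_multI) auto
  show "H \<subseteq> L"
  proof
    fix h assume "h \<in> H"
    then show "h \<in> L" using LI[of h 0] G by auto
  qed
  show "g \<in> L" using LI[OF subgroup.one_closed[OF sub(1)], of 1] gG by simp
  show LK: "L \<subseteq> K"
  proof
    fix x assume "x \<in> L"
    then obtain h and m :: int where "h \<in> H" "x = h \<otimes> g [^] m" by (auto simp: L_def set_mult_def)
    then show "x \<in> K" using gm sub by (auto simp: subgroup.m_closed)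
  qed
  show "subgroup L G"
  proof (rule subgroupI)
    show "L \<subseteq> carrier G" using LK G by auto
    show "L \<noteq> {}" using \<open>g \<in> L\<close> by auto
  next
    fix x assume "x \<in> L"
    then obtain h and m :: int where x: "h \<in> H" "x = h \<otimes> g [^] m" by (auto simp: L_def set_mult_def)
    have "g [^] (-m) \<otimes> inv h \<otimes> inv (g [^] (-m)) \<in> H"
      using abelian_section_conj[OF S gm] subgroup.m_inv_closed[OF sub(1) x(1)] by blast
    from LI[OF this, of "-m"] show "inv x \<in> L"
      using x gG G by (simp add: m_assoc inv_mult_group int_pow_neg subset_iff)
  next
    fix x y assume "x \<in> L" "y \<in> L"
    then obtain h h' and m m' :: int where xy: "h \<in> H" "x = h \<otimes> g [^] m" "h' \<in> H" "y = h' \<otimes> g [^] m'"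
      by (auto simp: L_def set_mult_def)
    have "h \<otimes> (g [^] m \<otimes> h' \<otimes> inv (g [^] m)) \<in> H"
      using abelian_section_conj[OF S gm xy(3)] subgroup.m_closed[OF sub(1) xy(1)] by blast
    from LI[OF this, of "m + m'"] show "x \<otimes> y \<in> L"
      using xy gG G by (simp add: m_assoc int_pow_mult subset_iff)
  qed
qed

text \<open>For an abelian section H, K containing g, these are the exponents whose power of g has
  the same image modulo H as some element of U. They record how the powers of g recur in K/H without
  forming the quotient.\<close>

definition return_times :: "'a set \<Rightarrow> 'a \<Rightarrow> 'a set \<Rightarrow> int set" where
  "return_times H g U = {m. g [^] m \<in> H <#> U}"

lemma return_times_mono: "m \<in> return_times H g U \<Longrightarrow> U \<subseteq> U' \<Longrightarrow> m \<in> return_times H g U'"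
  by (auto simp: return_times_def set_mult_def)

context
  fixes H K g
  assumes S: "abelian_section H K" and g: "g \<in> K"
begin

text \<open>H and the powers of g lie in K, so the factor u lies in K as well, although U need not
  be contained in K. This is what allows H to be conjugated by u.\<close>

lemma return_times_factor:
  assumes "m \<in> return_times H g U" "U \<subseteq> carrier G"
  obtains h u where "h \<in> H" "u \<in> U" "u \<in> K" "g [^] m = h \<otimes> u"
proof -
  obtain h u where hu: "h \<in> H" "u \<in> U" "g [^] m = h \<otimes> u"
    using assms by (auto simp: return_times_def set_mult_def)
  have sub: "subgroup H G" "subgroup K G" "H \<subseteq> K" using S by (auto simp: abelian_section_def)
  have "inv h \<otimes> g [^] m \<in> K"
    using subgroup.m_closed[OF sub(2) subgroup.m_inv_closed[OF sub(2)] subgroup_int_pow_closed[OF sub(2) g]]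
      hu(1) sub(3) by blast
  moreover have "h \<in> carrier G" "u \<in> carrier G"
    using hu assms abelian_section_subset[OF S] by auto
  ultimately have "u \<in> K" using hu by simp
  then show thesis using that hu by blast
qed

text \<open>The product of h u and h' u' equals h (u h' inv u) times u u', and u normalizes
  H.\<close>

lemma return_times_add:
  assumes "m \<in> return_times H g U" "m' \<in> return_times H g U'" "U \<subseteq> carrier G" "U' \<subseteq> carrier G"
  shows "m + m' \<in> return_times H g (U <#> U')"
proof -
  obtain h u where hu: "h \<in> H" "u \<in> U" "u \<in> K" "g [^] m = h \<otimes> u"
    using return_times_factor[OF assms(1,3)] .
  obtain h' u' where hu': "h' \<in> H" "u' \<in> U'" "u' \<in> K" "g [^] m' = h' \<otimes> u'"
    using return_times_factor[OF assms(2,4)] .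
  have sub: "subgroup H G" using S by (auto simp: abelian_section_def)
  have "h \<otimes> (u \<otimes> h' \<otimes> inv u) \<in> H"
    by (rule subgroup.m_closed[OF sub hu(1) abelian_section_conj[OF S hu(3) hu'(1)]])
  then have "h \<otimes> (u \<otimes> h' \<otimes> inv u) \<otimes> (u \<otimes> u') \<in> H <#> (U <#> U')"
    using hu hu' by (intro set_multI)
  moreover have "h \<in> carrier G" "u \<in> carrier G" "h' \<in> carrier G" "u' \<in> carrier G" "g \<in> carrier G"
    using hu hu' assms abelian_section_subset[OF S] g by auto
  ultimately show ?thesis
    using hu hu' by (simp add: return_times_def int_pow_mult m_assoc)
qed

lemma return_times_minus:
  assumes "m \<in> return_times H g U" "U \<subseteq> carrier G"
  shows "- m \<in> return_times H g (m_inv G ` U)"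
proof -
  obtain h u where hu: "h \<in> H" "u \<in> U" "u \<in> K" "g [^] m = h \<otimes> u"
    using return_times_factor[OF assms] .
  have sub: "subgroup H G" "subgroup K G" using S by (auto simp: abelian_section_def)
  have "inv u \<otimes> inv h \<otimes> inv (inv u) \<in> H"
    using abelian_section_conj[OF S subgroup.m_inv_closed[OF sub(2) hu(3)]
        subgroup.m_inv_closed[OF sub(1) hu(1)]] .
  then have "inv u \<otimes> inv h \<otimes> inv (inv u) \<otimes> inv u \<in> H <#> m_inv G ` U"
    using hu by (intro set_multI) auto
  moreover have "h \<in> carrier G" "u \<in> carrier G" "g \<in> carrier G"
    using hu assms abelian_section_subset[OF S] g by auto
  ultimately show ?thesis
    using hu by (simp add: return_times_def int_pow_neg m_assoc inv_mult_group)
qed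

text \<open>Cover C by finitely many translates \<open>V #> c\<close>. Two times landing in the same
  translate differ by a return time to U, because c cancels in the quotient of v c and v' c. One
  representative for each occupied translate therefore suffices.\<close>

lemma return_times_finite_net:
  assumes C: "compactin T C" and U: "openin T U" "\<one> \<in> U" and Z: "Z \<subseteq> return_times H g C"
  obtains F where "finite F" "F \<subseteq> Z" "\<And>z. z \<in> Z \<Longrightarrow> \<exists>f\<in>F. z - f \<in> return_times H g U"
proof -
  obtain V where V: "openin T V" "\<one> \<in> V" "\<And>x y. x \<in> V \<Longrightarrow> y \<in> V \<Longrightarrow> x \<otimes> inv y \<in> U"
    using small_neighbourhood[OF U] by metis
  obtain F0 where F0: "finite F0" "F0 \<subseteq> C" "C \<subseteq> (\<Union>c\<in>F0. V #> c)"
    using finite_translate_cover[OF C V(1,2)] .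
  have CG: "C \<subseteq> carrier G" using C compactin_subset_carrier by blast
  have VG: "V \<subseteq> carrier G" using V(1) openin_subset topspace_eq_carrier by metis
  define Zc where "Zc c = {z \<in> Z. z \<in> return_times H g (C \<inter> (V #> c))}" for c
  define rep where "rep c = (SOME z. z \<in> Zc c)" for c
  have rep: "rep c \<in> Zc c" if "z \<in> Zc c" for z c using that unfolding rep_def by (rule someI)
  have diff: "z - f \<in> return_times H g U" if c: "c \<in> F0" "z \<in> Zc c" "f \<in> Zc c" for z f c
  proof -
    let ?W = "C \<inter> (V #> c)"
    have WG: "?W \<subseteq> carrier G" using CG by auto
    have "z + - f \<in> return_times H g (?W <#> m_inv G ` ?W)"
      using c WG by (intro return_times_add return_times_minus) (auto simp: Zc_def)
    moreover have "?W <#> m_inv G ` ?W \<subseteq> U"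
    proof
      fix x assume "x \<in> ?W <#> m_inv G ` ?W"
      then obtain v v' where v: "v \<in> V" "v' \<in> V" "x = (v \<otimes> c) \<otimes> inv (v' \<otimes> c)"
        by (auto simp: set_mult_def r_coset_def)
      moreover have "v \<in> carrier G" "v' \<in> carrier G" "c \<in> carrier G" using v c F0 CG VG by auto
      ultimately have "x = v \<otimes> inv v'" by (simp add: m_assoc inv_mult_group)
      then show "x \<in> U" using v V by simp
    qed
    ultimately show ?thesis using return_times_mono by auto
  qed
  define F where "F = rep ` {c \<in> F0. Zc c \<noteq> {}}"
  show thesis
  proof (rule that)
    show "finite F" using F0 by (auto simp: F_def)
    show "F \<subseteq> Z" using rep by (fastforce simp: F_def Zc_def)
    fix z assume z: "z \<in> Z"
    then obtain h u where hu: "h \<in> H" "u \<in> C" "g [^] z = h \<otimes> u"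
      using Z by (auto simp: return_times_def set_mult_def)
    then obtain c where c: "c \<in> F0" "u \<in> V #> c" using F0 by blast
    then have "h \<otimes> u \<in> H <#> (C \<inter> (V #> c))" using hu by (intro set_multI) auto
    then have "z \<in> Zc c" using z hu by (simp add: Zc_def return_times_def)
    then show "\<exists>f\<in>F. z - f \<in> return_times H g U"
      using diff[OF c(1), of z "rep c"] rep[of z c] c by (auto simp: F_def)
  qed
qed

text \<open>The infinitely many return times to C lie in a finite set plus the return times to U',
  so the latter are infinite in number. As U' and its inverses lie in U, a large one may be taken
  positive.\<close>

lemma return_times_unbounded:
  assumes C: "compactin T C" "infinite (return_times H g C)" and U: "openin T U" "\<one> \<in> U"
  obtains e where "e \<in> return_times H g U" "e > N"
proof -
  define U' where "U' = {x \<in> topspace T. inv x \<in> U} \<inter> U"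
  have U': "openin T U'" "\<one> \<in> U'" "U' \<subseteq> U" "m_inv G ` U' \<subseteq> U" "U' \<subseteq> carrier G"
    using openin_Int[OF openin_continuous_map_preimage[OF continuous_inv U(1)] U(1)] U
    by (auto simp: U'_def topspace_eq_carrier)
  obtain F where F: "finite F" "\<And>z. z \<in> return_times H g C \<Longrightarrow> \<exists>f\<in>F. z - f \<in> return_times H g U'"
    using return_times_finite_net[OF C(1) U'(1,2) subset_refl] by metis
  have "return_times H g C \<subseteq> (\<lambda>(f, p). f + p) ` (F \<times> return_times H g U')"
  proof
    fix z assume "z \<in> return_times H g C"
    then obtain f where "f \<in> F" "z - f \<in> return_times H g U'" using F by blast
    then show "z \<in> (\<lambda>(f, p). f + p) ` (F \<times> return_times H g U')" by force
  qed
  then have "infinite (return_times H g U')"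
    using C F finite_subset by (metis finite_SigmaI finite_imageI)
  then have "\<not> return_times H g U' \<subseteq> {-\<bar>N\<bar>..\<bar>N\<bar>}" using finite_subset by blast
  then obtain e where e: "e \<in> return_times H g U'" "\<bar>e\<bar> > \<bar>N\<bar>" by fastforce
  have "e \<in> return_times H g U" "-e \<in> return_times H g U"
    using return_times_mono e(1) return_times_minus[OF e(1)] U' by blast+
  then show thesis using that[of e] that[of "-e"] e by linarith
qed

text \<open>Weil's dichotomy modulo \<open>H\<close>: a monothetic group is discrete or relatively compact. If the
  powers of \<open>g\<close> recur, the return times to a compact neighbourhood have bounded gaps.\<close>

lemma recurrent_imp_relatively_compact:
  assumes C: "compactin T C" "infinite (return_times H g C)"
  shows "\<exists>Q. compactin T Q \<and> range (\<lambda>m::int. g [^] m) \<subseteq> H <#> Q"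
proof -
  obtain V C0 where V: "openin T V" "\<one> \<in> V" "V \<subseteq> C0" "compactin T C0"
    using relatively_compact_neighbourhood[OF one_closed] .
  let ?P = "return_times H g V"
  obtain U where U: "openin T U" "\<one> \<in> U" "\<And>x y. x \<in> U \<Longrightarrow> y \<in> U \<Longrightarrow> x \<otimes> inv y \<in> V"
    using small_neighbourhood[OF V(1,2)] by metis
  have UG: "U \<subseteq> carrier G" using U(1) openin_subset topspace_eq_carrier by metis
  have C0G: "C0 \<subseteq> carrier G" using V compactin_subset_carrier by blast
  have "?P \<subseteq> return_times H g C0" using return_times_mono V(3) by blast
  then obtain F where F: "finite F" "F \<subseteq> ?P" "\<And>z. z \<in> ?P \<Longrightarrow> \<exists>f\<in>F. z - f \<in> return_times H g U"
    using return_times_finite_net[OF V(4) U(1,2)] by metis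
  \<comment> \<open>Each f in the net is paired with a return time e f to U so large that the shift
    f + e f is positive; B bounds these finitely many shifts.\<close>
  have "\<exists>e. e \<in> return_times H g U \<and> e > - f" for f
    using return_times_unbounded[OF C U(1,2), of "-f"] by blast
  then obtain e where e: "\<And>f. e f \<in> return_times H g U" "\<And>f. e f > - f" by metis
  obtain B where B: "\<And>f. f \<in> F \<Longrightarrow> f + e f \<le> B"
  proof -
    have "bdd_above ((\<lambda>f. f + e f) ` F)" using F(1) by (simp add: bdd_above_finite)
    then show thesis using that by (auto simp: bdd_above_def)
  qed
  \<comment> \<open>Modulo H, subtracting f leads into U, and subtracting e f as well leads to a
    quotient of two elements of U, hence into V. So from every return time to V a backward step of
    at most B reaches another one.\<close>
  have gap: "\<exists>m. 0 < m \<and> m \<le> B \<and> n - m \<in> ?P" if n: "n \<in> ?P" for n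
  proof -
    obtain f where f: "f \<in> F" "n - f \<in> return_times H g U" using F(3)[OF n] by blast
    have "(n - f) + - e f \<in> return_times H g (U <#> m_inv G ` U)"
      using f e UG by (intro return_times_add return_times_minus) auto
    moreover have "U <#> m_inv G ` U \<subseteq> V" using U by (auto simp: set_mult_def)
    ultimately have "(n - f) + - e f \<in> ?P" by (rule return_times_mono)
    then show ?thesis using B[OF f(1)] e(2)[of f] by (intro exI[of _ "f + e f"]) (auto simp: algebra_simps)
  qed
  have gG: "g \<in> carrier G" using g abelian_section_subset[OF S] by auto
  let ?Q = "C0 <#> (\<lambda>k::int. g [^] (- k)) ` {0..B}"
  have "compactin T ?Q" using gG by (intro compactin_set_mult[OF V(4)] compactin_finite) auto
  moreover have "g [^] p \<in> H <#> ?Q" for p :: int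
  proof -
    obtain n where n: "n \<in> ?P" "n > p" using return_times_unbounded[OF C V(1,2), of p] .
    \<comment> \<open>This is the first return at or after p. Were it more than B away, the backward
      step would give an earlier one that is still not before p.\<close>
    define k where "k = (LEAST k. p + int k \<in> ?P)"
    have "p + int (nat (n - p)) \<in> ?P" using n by simp
    then have k: "p + int k \<in> ?P" unfolding k_def by (rule LeastI)
    have "int k \<le> B"
    proof (rule ccontr)
      assume "\<not> int k \<le> B"
      obtain m where m: "0 < m" "m \<le> B" "p + int k - m \<in> ?P" using gap[OF k] by blast
      then have "p + int (k - nat m) \<in> ?P" using \<open>\<not> int k \<le> B\<close> by (simp add: of_nat_diff algebra_simps)
      then have "k \<le> k - nat m" unfolding k_def by (rule Least_le)
      then show False using m \<open>\<not> int k \<le> B\<close> by auto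
    qed
    obtain h v where hv: "h \<in> H" "v \<in> V" "g [^] (p + int k) = h \<otimes> v"
      using k by (auto simp: return_times_def set_mult_def)
    have "h \<otimes> (v \<otimes> g [^] (- int k)) \<in> H <#> ?Q"
      using hv V \<open>int k \<le> B\<close> by (intro set_multI imageI) auto
    moreover have "h \<in> carrier G" "v \<in> carrier G"
      using hv V C0G abelian_section_subset[OF S] by auto
    moreover have "g [^] p = g [^] (p + int k) \<otimes> g [^] (- int k)"
      using int_pow_mult[OF gG, of "p + int k" "- int k"] by simp
    ultimately show ?thesis using hv gG by (simp add: m_assoc)
  qed
  ultimately show ?thesis by blast
qed

end

section \<open>Adjoining a discrete infinite cyclic group\<close>

lemma closedin_r_translate:
  assumes "closedin T H" "c \<in> carrier G"
  shows "closedin T (H #> c)"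
proof -
  have HG: "H \<subseteq> carrier G" using closedin_subset[OF assms(1)] by (simp add: topspace_eq_carrier)
  have "openin T (topspace T - H)" using assms(1) by (simp add: closedin_def)
  then have "openin T ((topspace T - H) #> c)" using assms(2) by (rule openin_r_translate)
  moreover have "(topspace T - H) #> c = topspace T - (H #> c)"
  proof (intro equalityI subsetI)
    fix x assume "x \<in> (topspace T - H) #> c"
    then obtain y where "y \<in> carrier G" "y \<notin> H" "x = y \<otimes> c"
      by (auto simp: r_coset_def topspace_eq_carrier)
    then show "x \<in> topspace T - (H #> c)"
      using assms(2) HG by (auto simp: r_coset_def topspace_eq_carrier subset_iff)
  next
    fix x assume x: "x \<in> topspace T - (H #> c)"
    then have xG: "x \<in> carrier G" by (simp add: topspace_eq_carrier)
    have eq: "x = x \<otimes> inv c \<otimes> c" using xG assms(2) by (simp add: m_assoc)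
    have "x \<otimes> inv c \<notin> H"
    proof
      assume "x \<otimes> inv c \<in> H"
      then have "x \<otimes> inv c \<otimes> c \<in> H #> c" unfolding r_coset_def by blast
      then show False using x eq by simp
    qed
    then have "x \<otimes> inv c \<otimes> c \<in> (topspace T - H) #> c"
      unfolding r_coset_def using xG assms(2) by (auto simp: topspace_eq_carrier)
    then show "x \<in> (topspace T - H) #> c" using eq by simp
  qed
  moreover have "H #> c \<subseteq> topspace T" using HG assms(2) by (auto simp: r_coset_def topspace_eq_carrier)
  ultimately show ?thesis by (simp add: closedin_def)
qed

lemma normal_in_subgroup:
  assumes "subgroup H G" "subgroup K G" "H \<subseteq> K"
    and conj: "\<And>x h. x \<in> K \<Longrightarrow> h \<in> H \<Longrightarrow> x \<otimes> h \<otimes> inv x \<in> H"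
  shows "H \<lhd> G\<lparr>carrier := K\<rparr>"
proof -
  interpret K: group "G\<lparr>carrier := K\<rparr>" by (rule subgroup_imp_group[OF assms(2)])
  show ?thesis
    unfolding K.normal_inv_iff
    using subgroup_incl[OF assms(1-3)] conj m_inv_consistent[OF assms(2)] by simp
qed

lemma abelian_section_normal: "abelian_section H K \<Longrightarrow> H \<lhd> G\<lparr>carrier := K\<rparr>"
  using normal_in_subgroup[of H K] abelian_section_conj by (auto simp: abelian_section_def)

context
  fixes H K g
  assumes S: "abelian_section H K" and g: "g \<in> K"
    and discrete: "\<And>C. compactin T C \<Longrightarrow> finite (return_times H g C)"
begin

text \<open>If m were nonzero, all its multiples would be return times to the compact set
  \<open>{\<one>}\<close>.\<close>

lemma discrete_pow_in_imp_0:
  assumes "g [^] (m::int) \<in> H" shows "m = 0"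
proof (rule ccontr)
  assume m: "m \<noteq> 0"
  have sub: "subgroup H G" using S by (auto simp: abelian_section_def)
  have gG: "g \<in> carrier G" using g abelian_section_subset[OF S] by auto
  have "range (\<lambda>k::int. m * k) \<subseteq> return_times H g {\<one>}"
  proof clarify
    fix k :: int
    have "g [^] (m * k) \<in> H"
      using subgroup_int_pow_closed[OF sub assms, of k] gG by (simp add: int_pow_pow)
    then have "g [^] (m * k) \<otimes> \<one> \<in> H <#> {\<one>}" by (intro set_multI) auto
    then show "m * k \<in> return_times H g {\<one>}" using gG by (simp add: return_times_def)
  qed
  moreover have "finite (return_times H g {\<one>})" by (intro discrete compactin_finite) auto
  ultimately have "finite (range (\<lambda>k::int. m * k))" using finite_subset by blast
  moreover have "inj (\<lambda>k::int. m * k)" using m by (auto intro: injI)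
  ultimately show False using finite_imageD infinite_UNIV_int by blast
qed

text \<open>A locally finite union of closed cosets is closed: a neighbourhood V inside a compact C
  meets only those \<open>H #> g [^] m\<close> for which m is a return time to C.\<close>

lemma closedin_adjoin_discrete:
  assumes H: "closedin T H"
  shows "closedin T (H <#> range (\<lambda>m::int. g [^] m))" (is "closedin T ?L")
proof -
  have gG: "g \<in> carrier G" using g abelian_section_subset[OF S] by auto
  have HG: "H \<subseteq> carrier G" using abelian_section_subset[OF S] by auto
  have sub: "subgroup H G" using S by (auto simp: abelian_section_def)
  have LG: "?L \<subseteq> carrier G" using gG HG by (auto simp: set_mult_def)
  have "T closure_of ?L \<subseteq> ?L"
  proof
    fix x assume x: "x \<in> T closure_of ?L"
    then have "x \<in> carrier G" by (simp add: in_closure_of topspace_eq_carrier)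
    then obtain V C where V: "openin T V" "x \<in> V" "V \<subseteq> C" "compactin T C"
      by (rule relatively_compact_neighbourhood)
    let ?F = "\<Union>m\<in>return_times H g (m_inv G ` C). H #> g [^] (- m)"
    have "finite (return_times H g (m_inv G ` C))"
      using discrete compactin_m_inv V by blast
    then have "closedin T ?F"
      using closedin_r_translate[OF H] gG by (intro closedin_Union) auto
    moreover have "V \<inter> ?L \<subseteq> ?F"
    proof
      fix y assume y: "y \<in> V \<inter> ?L"
      then obtain h and m :: int where hm: "h \<in> H" "y = h \<otimes> g [^] m"
        by (auto simp: set_mult_def)
      have yG: "y \<in> carrier G" using y LG by auto
      have h: "h \<in> carrier G" using hm HG by auto
      have "g [^] m = inv h \<otimes> y" using hm h gG by simp
      moreover have "inv h \<in> H" by (rule subgroup.m_inv_closed[OF sub hm(1)])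
      ultimately have "m \<in> return_times H g C"
        using y V set_multI[of "inv h" H y C] by (auto simp: return_times_def)
      then have "- m \<in> return_times H g (m_inv G ` C)"
        using return_times_minus[OF S g] compactin_subset_carrier[OF V(4)] by blast
      moreover have "y \<in> H #> g [^] (- (- m))" using hm by (auto simp: r_coset_def)
      ultimately show "y \<in> ?F" by blast
    qed
    ultimately have "T closure_of (V \<inter> ?L) \<subseteq> ?F" by (intro closure_of_minimal)
    then have "x \<in> ?F"
      using openin_Int_closure_of_subset[OF V(1), of ?L] x V by blast
    then show "x \<in> ?L" by (auto simp: r_coset_def set_mult_def)
  qed
  then show ?thesis
    using LG closure_of_subset_eq[of ?L T] by (simp add: topspace_eq_carrier)
qed

text \<open>Powers of g are distinct modulo H, so the exponent m of h \<open>g [^] m\<close> is well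
  defined. It gives a homomorphism onto the integers with kernel H, bounded on compact sets because
  its values there are return times.\<close>

lemma asdim_at_most_adjoin_discrete:
  assumes "asdim_at_most H n"
  shows "asdim_at_most (H <#> range (\<lambda>m::int. g [^] m)) (Suc n)" (is "asdim_at_most ?L _")
proof -
  have sub: "subgroup H G" "subgroup K G" using S by (auto simp: abelian_section_def)
  have gG: "g \<in> carrier G" using g abelian_section_subset[OF S] by auto
  have HG: "H \<subseteq> carrier G" using abelian_section_subset[OF S] by auto
  have gK: "g [^] (m::int) \<in> K" for m using subgroup_int_pow_closed[OF sub(2) g] .
  define \<pi> where "\<pi> x = (THE m::int. \<exists>h\<in>H. x = h \<otimes> g [^] m)" for x
  have \<pi>: "\<pi> (h \<otimes> g [^] m) = m" if h: "h \<in> H" for h and m :: int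
    unfolding \<pi>_def
  proof (rule the_equality)
    show "\<exists>h'\<in>H. h \<otimes> g [^] m = h' \<otimes> g [^] m" using h by blast
    fix k :: int assume "\<exists>h'\<in>H. h \<otimes> g [^] m = h' \<otimes> g [^] k"
    then obtain h' where h': "h' \<in> H" "h \<otimes> g [^] m = h' \<otimes> g [^] k" by blast
    have G: "h \<in> carrier G" "h' \<in> carrier G" using h h' HG by auto
    have "inv h' \<otimes> (h \<otimes> g [^] m) \<otimes> inv (g [^] m) = inv h' \<otimes> (h' \<otimes> g [^] k) \<otimes> inv (g [^] m)"
      using h' by simp
    then have "inv h' \<otimes> h = g [^] (k - m)" using G gG by (simp add: m_assoc int_pow_diff)
    moreover have "inv h' \<otimes> h \<in> H" using sub h h' by (simp add: subgroup.m_closed subgroup.m_inv_closed)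
    ultimately show "k = m" using discrete_pow_in_imp_0[of "k - m"] by simp
  qed
  have L: "\<exists>h\<in>H. \<exists>m::int. x = h \<otimes> g [^] m" if "x \<in> ?L" for x
    using that by (auto simp: set_mult_def)
  have LI: "h \<otimes> g [^] (m::int) \<in> ?L" if "h \<in> H" for h m using that by (intro set_multI) auto
  have ker: "{x \<in> ?L. \<pi> x = 0} = H"
  proof (intro equalityI subsetI)
    fix x assume "x \<in> {x \<in> ?L. \<pi> x = 0}"
    then obtain h where "h \<in> H" "x = h \<otimes> g [^] (0::int)" using L \<pi> by fastforce
    then show "x \<in> H" using HG by auto
  next
    fix x assume x: "x \<in> H"
    moreover from x have "x = x \<otimes> g [^] (0::int)" using HG by auto
    ultimately show "x \<in> {x \<in> ?L. \<pi> x = 0}" using LI[OF x, of 0] \<pi>[OF x, of 0] by simp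
  qed
  show ?thesis
  proof (rule asdim_at_most_int_extension[where \<pi> = \<pi> and g = g])
    show "subgroup ?L G" "g \<in> ?L" by (rule subgroup_adjoin[OF S g])+
    show "\<pi> g = 1" using \<pi>[OF subgroup.one_closed[OF sub(1)], of 1] gG by simp
    show "asdim_at_most {x \<in> ?L. \<pi> x = 0} n" using assms ker by simp
  next
    fix x y assume "x \<in> ?L" "y \<in> ?L"
    then obtain h h' and m m' :: int where xy: "h \<in> H" "x = h \<otimes> g [^] m" "h' \<in> H" "y = h' \<otimes> g [^] m'"
      using L by meson
    have "h \<otimes> (g [^] m \<otimes> h' \<otimes> inv (g [^] m)) \<in> H"
      using subgroup.m_closed[OF sub(1) xy(1) abelian_section_conj[OF S gK xy(3)]] .
    from \<pi>[OF this, of "m + m'"] have "\<pi> (x \<otimes> y) = m + m'"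
      using xy gG HG by (simp add: m_assoc int_pow_mult subset_iff)
    then show "\<pi> (x \<otimes> y) = \<pi> x + \<pi> y" using xy \<pi> by simp
  next
    fix C assume C: "compactin T C"
    have "\<pi> c \<in> return_times H g C" if c: "c \<in> C \<inter> ?L" for c
    proof -
      obtain h and m :: int where hm: "h \<in> H" "c = h \<otimes> g [^] m" using c L by blast
      have h: "h \<in> carrier G" using hm HG by auto
      have "g [^] m = inv h \<otimes> c" using hm h gG by simp
      moreover have "inv h \<in> H" using hm sub by (simp add: subgroup.m_inv_closed)
      ultimately have "m \<in> return_times H g C"
        using c set_multI[of "inv h" H c C] by (simp add: return_times_def)
      then show ?thesis using hm \<pi> by simp
    qed
    moreover have "finite (abs ` return_times H g C)" using discrete[OF C] by simp
    then have "bdd_above (abs ` return_times H g C)" by (rule bdd_above_finite)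
    then obtain r where "\<And>m. m \<in> abs ` return_times H g C \<Longrightarrow> m \<le> r"
      unfolding bdd_above_def by blast
    ultimately show "\<exists>r. \<forall>c\<in>C \<inter> ?L. \<bar>\<pi> c\<bar> < r"
      by (intro exI[of _ "r + 1"]) force
  qed
qed

text \<open>This certifies the adjoined factor as one that the Hirsch length counts.\<close>

lemma infinite_cyclic_adjoin_discrete:
  defines "A \<equiv> G\<lparr>carrier := H <#> range (\<lambda>m::int. g [^] m)\<rparr>"
  shows "cyclic_group (A Mod H)" "infinite (carrier (A Mod H))"
proof -
  let ?L = "H <#> range (\<lambda>m::int. g [^] m)"
  note L = subgroup_adjoin[OF S g]
  have sub: "subgroup H G" "subgroup K G" using S by (auto simp: abelian_section_def)
  have gG: "g \<in> carrier G" using g abelian_section_subset[OF S] by auto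
  have HG: "H \<subseteq> carrier G" using abelian_section_subset[OF S] by auto
  have "H \<lhd> A" unfolding A_def
    by (rule normal_in_subgroup[OF sub(1) L(1,2)]) (use L(4) abelian_section_conj[OF S] in blast)
  then interpret N: normal H A .
  interpret Q: group "A Mod H" by (rule N.factorgroup_is_group)
  have coset: "H #>\<^bsub>A\<^esub> x = H #> x" for x by (simp add: A_def r_coset_def)
  have pow: "(H #> g) [^]\<^bsub>A Mod H\<^esub> (m::int) = H #> g [^] m" for m
    using N.FactGroup_int_pow[of g m] L(3) int_pow_consistent[OF L(1,3), of m]
    by (simp add: coset) (simp add: A_def)
  have carr: "carrier (A Mod H) = range (\<lambda>m::int. H #> g [^] m)"
  proof -
    have "H #> (h \<otimes> g [^] m) = H #> g [^] m" if "h \<in> H" for h and m :: int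
      using coset_mult_assoc[OF HG, of h "g [^] m"] coset_join2[of h H] that sub HG gG by auto
    moreover have "carrier (A Mod H) = (\<lambda>x. H #> x) ` ?L"
      by (simp add: carrier_FactGroup coset) (simp add: A_def)
    moreover have "g [^] (m::int) \<in> ?L" for m using subgroup_int_pow_closed[OF L(1,3)] .
    ultimately show ?thesis by (fastforce simp: set_mult_def)
  qed
  have "H #> g \<in> carrier (A Mod H)" using carr gG rangeI[of "\<lambda>m::int. H #> g [^] m" 1] by simp
  then show "cyclic_group (A Mod H)" 
    unfolding Q.cyclic_group using carr pow by (intro bexI[of _ "H #> g"]) simp_all
  have "inj (\<lambda>m::int. H #> g [^] m)"
  proof (rule injI)
    fix m k :: int assume eq: "H #> g [^] m = H #> g [^] k"
    have "\<one> \<otimes> g [^] m \<in> H #> g [^] m"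
      using subgroup.one_closed[OF sub(1)] unfolding r_coset_def by blast
    then obtain h where h: "h \<in> H" "\<one> \<otimes> g [^] m = h \<otimes> g [^] k" unfolding eq by (auto simp: r_coset_def)
    then have "g [^] (m - k) = h" using gG HG by (auto simp: int_pow_diff m_assoc)
    then show "m = k" using h discrete_pow_in_imp_0[of "m - k"] by simp
  qed
  then show "infinite (carrier (A Mod H))"
    unfolding carr using finite_imageD infinite_UNIV_int by blast
qed

end

subsection \<open>Locally elliptic sections\<close>

text \<open>Generators are adjoined one at a time. If \<open>f [^] m\<close> is h q, then l h is
  still in L, hence in \<open>H <#> Q\<close>, so l times \<open>f [^] m\<close> lies in
  \<open>H <#> (Q <#> Q')\<close>. Compactness is measured modulo the fixed H, not modulo the
  growing L.\<close>

lemma finitely_generated_relatively_compact: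
  assumes S: "abelian_section H K" and "finite F" "F \<subseteq> K"
    and cpt: "\<And>g. g \<in> K \<Longrightarrow> \<exists>Q. compactin T Q \<and> range (\<lambda>m::int. g [^] m) \<subseteq> H <#> Q"
  shows "\<exists>L Q. subgroup L G \<and> H \<subseteq> L \<and> L \<subseteq> K \<and> F \<subseteq> L \<and> compactin T Q \<and> L \<subseteq> H <#> Q"
  using assms(2,3)
proof (induction F rule: finite_induct)
  case empty
  have "H \<subseteq> H <#> {\<one>}"
  proof
    fix h assume h: "h \<in> H"
    then have "h \<otimes> \<one> \<in> H <#> {\<one>}" by (intro set_multI) auto
    then show "h \<in> H <#> {\<one>}" using h abelian_section_subset[OF S] by auto
  qed
  moreover have "compactin T {\<one>}" by (rule compactin_finite) auto
  ultimately show ?case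
    using S by (intro exI[of _ H] exI[of _ "{\<one>}"]) (simp add: abelian_section_def)
next
  case (insert f F)
  then obtain L Q where L: "subgroup L G" "H \<subseteq> L" "L \<subseteq> K" "F \<subseteq> L" "compactin T Q" "L \<subseteq> H <#> Q"
    by blast
  have f: "f \<in> K" using insert by auto
  obtain Q' where Q': "compactin T Q'" "range (\<lambda>m::int. f [^] m) \<subseteq> H <#> Q'" using cpt[OF f] by blast
  have SL: "abelian_section L K" using abelian_section_mono[OF S L(1-3)] .
  let ?L = "L <#> range (\<lambda>m::int. f [^] m)"
  have HG: "H \<subseteq> carrier G" "K \<subseteq> carrier G" using abelian_section_subset[OF S] by auto
  have QG: "Q \<subseteq> carrier G" "Q' \<subseteq> carrier G" using L Q' compactin_subset_carrier by auto
  have "?L \<subseteq> H <#> (Q <#> Q')"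
  proof
    fix x assume "x \<in> ?L"
    then obtain l and m :: int where x: "l \<in> L" "x = l \<otimes> f [^] m" by (auto simp: set_mult_def)
    have "f [^] m \<in> H <#> Q'" using Q' by blast
    then obtain h q where hq: "h \<in> H" "q \<in> Q'" "f [^] m = h \<otimes> q"
      unfolding set_mult_def by blast
    have "l \<otimes> h \<in> L" using x hq L subgroup.m_closed[OF L(1)] by blast
    then obtain h' q' where hq': "h' \<in> H" "q' \<in> Q" "l \<otimes> h = h' \<otimes> q'"
      using L(6) unfolding set_mult_def by blast
    have G: "l \<in> carrier G" "h \<in> carrier G" "q \<in> carrier G" "h' \<in> carrier G" "q' \<in> carrier G"
      using x L HG QG hq hq' by auto
    have "x = l \<otimes> h \<otimes> q" using x hq G by (simp add: m_assoc)
    also have "\<dots> = h' \<otimes> (q' \<otimes> q)" using hq' G by (simp add: m_assoc)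
    finally show "x \<in> H <#> (Q <#> Q')" using hq hq' by (auto intro: set_multI)
  qed
  moreover have "compactin T (Q <#> Q')" using L Q' by (intro compactin_set_mult)
  moreover have "H \<subseteq> ?L" "insert f F \<subseteq> ?L" using subgroup_adjoin[OF SL f] L by auto
  ultimately show ?case using subgroup_adjoin(1,4)[OF SL f] by blast
qed

text \<open>Take a compact symmetric B in K containing \<open>C \<inter> K\<close> and a
  neighbourhood of \<one> in K. Finitely many translates of this neighbourhood cover
  \<open>B <#> B\<close>, and the translating elements lie in a subgroup L that is relatively
  compact modulo H. So \<open>B <#> B\<close> is contained in \<open>B <#> L\<close>, and as L is
  normal in K, the set \<open>B <#> L\<close> is already a subgroup.\<close>

lemma locally_elliptic_section:
  assumes S: "abelian_section H K" and K: "closedin T K" and C: "compactin T C"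
    and cpt: "\<And>g. g \<in> K \<Longrightarrow> \<exists>Q. compactin T Q \<and> range (\<lambda>m::int. g [^] m) \<subseteq> H <#> Q"
  shows "\<exists>L Q. subgroup L G \<and> L \<subseteq> K \<and> C \<inter> K \<subseteq> L \<and> compactin T Q \<and> L \<subseteq> H <#> Q"
proof -
  obtain V C0 where V: "openin T V" "\<one> \<in> V" "V \<subseteq> C0" "compactin T C0"
    using relatively_compact_neighbourhood[OF one_closed] .
  have sub: "subgroup K G" using S by (auto simp: abelian_section_def)
  have KG: "K \<subseteq> carrier G" using abelian_section_subset[OF S] by auto
  define B where "B = symmetrization (C \<union> C0) \<inter> K"
  have B: "compactin T B"
    unfolding B_def using C V K
    by (intro compact_Int_closedin compactin_symmetrization compactin_Un)
  have BK: "B \<subseteq> K" by (auto simp: B_def)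
  have Binv: "inv b \<in> B" if "b \<in> B" for b
  proof -
    have "C \<union> C0 \<subseteq> carrier G" using C V compactin_subset_carrier by blast
    then show ?thesis
      using that inv_in_symmetrization[of "C \<union> C0" b] sub by (auto simp: B_def subgroup.m_inv_closed)
  qed
  obtain F where F: "finite F" "F \<subseteq> B <#> B" "B <#> B \<subseteq> (\<Union>c\<in>F. V #> c)"
    using finite_translate_cover[OF compactin_set_mult[OF B B] V(1,2)] .
  have BBK: "B <#> B \<subseteq> K" using BK subgroup.m_closed[OF sub] by (auto simp: set_mult_def)
  then have FK: "F \<subseteq> K" using F by auto
  obtain L Q where L: "subgroup L G" "H \<subseteq> L" "L \<subseteq> K" "F \<subseteq> L" "compactin T Q" "L \<subseteq> H <#> Q"
    using finitely_generated_relatively_compact[OF S F(1) FK cpt] by blast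
  have SL: "abelian_section L K" using abelian_section_mono[OF S L(1-3)] .
  have BBL: "\<exists>b\<in>B. \<exists>l\<in>L. x = b \<otimes> l" if x: "x \<in> B <#> B" for x
  proof -
    obtain c v where cv: "c \<in> F" "v \<in> V" "x = v \<otimes> c" using x F by (auto simp: r_coset_def)
    have "c \<in> K" "x \<in> K" using cv FK x BBK by auto
    then have "x \<otimes> inv c \<in> K" using sub by (simp add: subgroup.m_closed subgroup.m_inv_closed)
    moreover have "c \<in> carrier G" "v \<in> carrier G"
      using \<open>c \<in> K\<close> KG cv V compactin_subset_carrier by auto
    ultimately have "v \<in> K" using cv by (simp add: m_assoc)
    then have "v \<in> B" using cv V by (auto simp: B_def symmetrization_def)
    then show ?thesis using cv L(4) by blast
  qed
  define M where "M = B <#> L"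
  have BG: "B \<subseteq> carrier G" and LG: "L \<subseteq> carrier G" using BK L KG by auto
  have MI: "b \<otimes> l \<in> M" if "b \<in> B" "l \<in> L" for b l using that by (auto simp: M_def intro: set_multI)
  have ME: "\<exists>b\<in>B. \<exists>l\<in>L. x = b \<otimes> l" if "x \<in> M" for x using that by (auto simp: M_def set_mult_def)
  have MK: "M \<subseteq> K"
  proof
    fix x assume "x \<in> M"
    then obtain b l where "b \<in> B" "l \<in> L" "x = b \<otimes> l" using ME by blast
    then show "x \<in> K" using BK L(3) subgroup.m_closed[OF sub] by blast
  qed
  have BM: "B \<subseteq> M"
  proof
    fix b assume "b \<in> B"
    then show "b \<in> M" using MI[of b \<one>] subgroup.one_closed[OF L(1)] BG by auto
  qed
  have "subgroup M G"
  proof (rule subgroupI)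
    show "M \<subseteq> carrier G" using MK KG by auto
    have "\<one> \<in> B" using subgroup.one_closed[OF sub] by (simp add: B_def symmetrization_def)
    then show "M \<noteq> {}" using BM by auto
  next
    fix x assume "x \<in> M"
    then obtain b l where bl: "b \<in> B" "l \<in> L" "x = b \<otimes> l" using ME by blast
    have "b \<otimes> inv l \<otimes> inv b \<in> L"
      using abelian_section_conj[OF SL _ subgroup.m_inv_closed[OF L(1) bl(2)]] bl BK by blast
    then have "inv b \<otimes> (b \<otimes> inv l \<otimes> inv b) \<in> M" using Binv bl MI by blast
    then show "inv x \<in> M" using bl BG LG by (simp add: inv_mult_group m_assoc subset_iff)
  next
    fix x y assume "x \<in> M" "y \<in> M"
    then obtain b l b' l' where bl: "b \<in> B" "l \<in> L" "x = b \<otimes> l" "b' \<in> B" "l' \<in> L" "y = b' \<otimes> l'"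
      using ME by meson
    have "b \<otimes> b' \<in> B <#> B" using bl by (intro set_multI)
    then obtain b2 l2 where bl2: "b2 \<in> B" "l2 \<in> L" "b \<otimes> b' = b2 \<otimes> l2" using BBL by blast
    have "inv b' \<in> K" using BK bl(4) subgroup.m_inv_closed[OF sub] by blast
    then have "inv b' \<otimes> l \<otimes> inv (inv b') \<in> L" using abelian_section_conj[OF SL _ bl(2)] by blast
    then have "l2 \<otimes> (inv b' \<otimes> l \<otimes> inv (inv b') \<otimes> l') \<in> L"
      using L(1) bl bl2 by (simp add: subgroup.m_closed)
    then have "b2 \<otimes> (l2 \<otimes> (inv b' \<otimes> l \<otimes> inv (inv b') \<otimes> l')) \<in> M" using MI bl2 by blast
    moreover have G: "b \<in> carrier G" "l \<in> carrier G" "b' \<in> carrier G" "l' \<in> carrier G"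
      "b2 \<in> carrier G" "l2 \<in> carrier G" using bl bl2 BG LG by auto
    moreover have "b2 \<otimes> (l2 \<otimes> (inv b' \<otimes> l \<otimes> inv (inv b') \<otimes> l'))
        = b \<otimes> b' \<otimes> (inv b' \<otimes> l \<otimes> inv (inv b') \<otimes> l')"
      using G bl2 by (simp add: m_assoc)
    ultimately show "x \<otimes> y \<in> M" using bl by (simp add: m_assoc)
  qed
  \<comment> \<open>Conjugating L by b moves b to the right end, where it joins the compact
    factor.\<close>
  moreover have "M \<subseteq> H <#> (Q <#> B)"
  proof
    fix x assume "x \<in> M"
    then obtain b l where bl: "b \<in> B" "l \<in> L" "x = b \<otimes> l" using ME by blast
    have "b \<otimes> l \<otimes> inv b \<in> L" using abelian_section_conj[OF SL _ bl(2)] bl BK by blast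
    then obtain h q where hq: "h \<in> H" "q \<in> Q" "b \<otimes> l \<otimes> inv b = h \<otimes> q"
      using L(6) unfolding set_mult_def by blast
    have G: "b \<in> carrier G" "l \<in> carrier G" "h \<in> carrier G" "q \<in> carrier G"
      using bl BG LG hq L(2) compactin_subset_carrier[OF L(5)] by auto
    have "x = b \<otimes> l \<otimes> inv b \<otimes> b" using bl G by (simp add: m_assoc)
    also have "\<dots> = h \<otimes> (q \<otimes> b)" using hq G by (simp add: m_assoc)
    finally show "x \<in> H <#> (Q <#> B)" using hq bl by (auto intro: set_multI)
  qed
  moreover have "compactin T (Q <#> B)" using L B by (intro compactin_set_mult)
  moreover have "C \<inter> K \<subseteq> M" using BM by (auto simp: B_def symmetrization_def)
  ultimately show ?thesis using MK by blast
qed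

subsection \<open>Closures of solvable subgroups\<close>

lemma continuous_map_mult:
  assumes "continuous_map X T f" "continuous_map X T f'"
  shows "continuous_map X T (\<lambda>p. f p \<otimes> f' p)"
  using continuous_map_compose[OF continuous_map_pairedI[OF assms] continuous_mult] by (simp add: o_def)

lemma continuous_map_m_inv:
  assumes "continuous_map X T f" shows "continuous_map X T (\<lambda>p. inv (f p))"
  using continuous_map_compose[OF assms continuous_inv] by (simp add: o_def)

lemma closure_of_continuous2:
  assumes f: "continuous_map (prod_topology T T) T (\<lambda>p. f (fst p) (snd p))"
    and AB: "\<And>x y. x \<in> A \<Longrightarrow> y \<in> A \<Longrightarrow> f x y \<in> B"
    and xy: "x \<in> T closure_of A" "y \<in> T closure_of A"
  shows "f x y \<in> T closure_of B"
proof -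
  have "(x, y) \<in> prod_topology T T closure_of (A \<times> A)" using xy by (simp add: closure_of_Times)
  then have "f (fst (x, y)) (snd (x, y)) \<in> T closure_of ((\<lambda>p. f (fst p) (snd p)) ` (A \<times> A))"
    using continuous_map_image_closure_subset[OF f, of "A \<times> A"] by blast
  moreover have "(\<lambda>p. f (fst p) (snd p)) ` (A \<times> A) \<subseteq> B" using AB by auto
  ultimately show ?thesis using closure_of_mono by fastforce
qed

lemma subgroup_closure_of:
  assumes H: "subgroup H G" shows "subgroup (T closure_of H) G"
proof (rule subgroupI)
  have HG: "H \<subseteq> topspace T" using subgroup.subset[OF H] by (simp add: topspace_eq_carrier)
  show "T closure_of H \<subseteq> carrier G"
    using closure_of_subset_topspace[of T H] by (simp add: topspace_eq_carrier)
  show "T closure_of H \<noteq> {}"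
    using closure_of_subset[OF HG] subgroup.one_closed[OF H] by blast
  have m: "continuous_map (prod_topology T T) T (\<lambda>p. fst p \<otimes> snd p)"
    by (intro continuous_map_mult continuous_map_fst continuous_map_snd)
  show "x \<otimes> y \<in> T closure_of H" if "x \<in> T closure_of H" "y \<in> T closure_of H" for x y
    using that subgroup.m_closed[OF H] by (intro closure_of_continuous2[OF m, of H H])
  have i: "continuous_map (prod_topology T T) T (\<lambda>p. inv (fst p))"
    by (intro continuous_map_m_inv continuous_map_fst)
  show "inv x \<in> T closure_of H" if "x \<in> T closure_of H" for x
    using closure_of_continuous2[where f = "\<lambda>x y. inv x", OF i _ that that, of H] subgroup.m_inv_closed[OF H]
    by blast
qed

lemma abelian_section_closure_of:
  assumes S: "abelian_section H K"
  shows "abelian_section (T closure_of H) (T closure_of K)"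
proof -
  have c: "continuous_map (prod_topology T T) T
      (\<lambda>p. fst p \<otimes> snd p \<otimes> inv (fst p) \<otimes> inv (snd p))"
    by (intro continuous_map_mult continuous_map_m_inv continuous_map_fst continuous_map_snd)
  have comm: "x \<otimes> y \<otimes> inv x \<otimes> inv y \<in> H" if "x \<in> K" "y \<in> K" for x y
    using S that by (auto simp: abelian_section_def)
  have "x \<otimes> y \<otimes> inv x \<otimes> inv y \<in> T closure_of H"
    if "x \<in> T closure_of K" "y \<in> T closure_of K" for x y
    using closure_of_continuous2[where f = "\<lambda>x y. x \<otimes> y \<otimes> inv x \<otimes> inv y", OF c comm that] .
  then show ?thesis
    using S subgroup_closure_of closure_of_mono[of H K T] by (auto simp: abelian_section_def)
qed

subsection \<open>Series of closed subgroups\<close>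

text \<open>The terms are closed in G, so L needs no topology of its own. The count is bounded below
  rather than fixed, so it survives appending an arbitrary factor.\<close>

definition closed_series_to :: "'a set \<Rightarrow> nat \<Rightarrow> bool" where
  "closed_series_to L k \<longleftrightarrow> (\<exists>m H. H 0 = {\<one>} \<and> H m = L \<and>
     (\<forall>i\<le>m. subgroup (H i) G \<and> closedin T (H i)) \<and>
     (\<forall>i<m. H i \<lhd> G\<lparr>carrier := H (Suc i)\<rparr>) \<and>
     k \<le> card (infinite_cyclic_factors G m H))"

lemma closed_series_to_mono: "closed_series_to L k \<Longrightarrow> j \<le> k \<Longrightarrow> closed_series_to L j"
  unfolding closed_series_to_def using order_trans by blast

lemma closedin_one: "closedin T {\<one>}"
  by (intro compactin_imp_closedin[OF Hausdorff] compactin_finite) auto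

lemma closed_series_to_one: "closed_series_to {\<one>} 0"
proof -
  have "subgroup {\<one>} G" by (rule subgroupI) auto
  then show ?thesis
    unfolding closed_series_to_def using closedin_one
    by (intro exI[of _ 0] exI[of _ "\<lambda>_. {\<one>}"]) auto
qed

lemma closed_series_to_extend:
  assumes "closed_series_to L k" and L': "subgroup L' G" "closedin T L'" "L \<lhd> G\<lparr>carrier := L'\<rparr>"
  shows "closed_series_to L' k"
    and "\<lbrakk>cyclic_group (G\<lparr>carrier := L'\<rparr> Mod L); infinite (carrier (G\<lparr>carrier := L'\<rparr> Mod L))\<rbrakk>
      \<Longrightarrow> closed_series_to L' (Suc k)"
proof -
  obtain m H where H: "H 0 = {\<one>}" "H m = L" "\<forall>i\<le>m. subgroup (H i) G \<and> closedin T (H i)"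
    "\<forall>i<m. H i \<lhd> G\<lparr>carrier := H (Suc i)\<rparr>" "k \<le> card (infinite_cyclic_factors G m H)"
    using assms(1) unfolding closed_series_to_def by blast
  define H' where "H' = H(Suc m := L')"
  have H'i: "H' i = H i" if "i \<le> m" for i using that by (auto simp: H'_def)
  have H'm: "H' (Suc m) = L'" by (simp add: H'_def)
  have fin: "finite (infinite_cyclic_factors G n A)" for n A
    by (rule finite_subset[of _ "{..<n}"]) (auto simp: infinite_cyclic_factors_def)
  have sub: "infinite_cyclic_factors G m H \<subseteq> infinite_cyclic_factors G (Suc m) H'"
    by (auto simp: infinite_cyclic_factors_def H'i)
  have new: "m \<notin> infinite_cyclic_factors G m H" by (simp add: infinite_cyclic_factors_def)
  have series: "closed_series_to L' j" if "j \<le> card (infinite_cyclic_factors G (Suc m) H')" for j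
    unfolding closed_series_to_def
  proof (intro exI[of _ "Suc m"] exI[of _ H'] conjI allI impI)
    show "H' 0 = {\<one>}" using H H'i by simp
    show "H' (Suc m) = L'" by (rule H'm)
    show "subgroup (H' i) G" "closedin T (H' i)" if "i \<le> Suc m" for i
      using that H(3) H'i H'm L' by (auto simp: le_Suc_eq)
    show "H' i \<lhd> G\<lparr>carrier := H' (Suc i)\<rparr>" if "i < Suc m" for i
      using that H(2,4) H'i H'm L'(3) by (cases "i = m") auto
    show "j \<le> card (infinite_cyclic_factors G (Suc m) H')" by (rule that)
  qed
  show "closed_series_to L' k"
    by (rule series[OF order_trans[OF H(5) card_mono[OF fin sub]]])
  assume "cyclic_group (G\<lparr>carrier := L'\<rparr> Mod L)" "infinite (carrier (G\<lparr>carrier := L'\<rparr> Mod L))"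
  then have "m \<in> infinite_cyclic_factors G (Suc m) H'"
    using H'i[of m] H'm H(2) by (simp add: infinite_cyclic_factors_def)
  then have "insert m (infinite_cyclic_factors G m H) \<subseteq> infinite_cyclic_factors G (Suc m) H'"
    using sub by blast
  from card_mono[OF fin this] have "Suc k \<le> card (infinite_cyclic_factors G (Suc m) H')"
    using new fin H(5) by simp
  then show "closed_series_to L' (Suc k)" by (rule series)
qed

text \<open>This is the invariant carried up the solvable series. In the second alternative the same
  k occurs twice, which encodes the inequality; the first alternative covers infinite Hirsch length,
  where no dimension bound is claimed.\<close>

definition asdim_bounded_by_series :: "'a set \<Rightarrow> bool" where
  "asdim_bounded_by_series L \<longleftrightarrow>
     (\<forall>k. closed_series_to L k) \<or> (\<exists>k. closed_series_to L k \<and> asdim_at_most L k)"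

text \<open>Adjoin to \<open>H\<close> elements of \<open>K\<close> that generate a discrete infinite cyclic group modulo the
  subgroup reached so far. If this does not go on forever, the remaining section is locally
  elliptic and does not contribute to the asymptotic dimension.\<close>

lemma asdim_bounded_by_series_abelian_section:
  assumes S: "abelian_section H K" and cl: "closedin T H" "closedin T K"
    and H: "asdim_bounded_by_series H"
  shows "asdim_bounded_by_series K"
proof (cases "\<forall>k. closed_series_to H k \<or> closed_series_to K k")
  case True
  have "closed_series_to K k" for k
    using True closed_series_to_extend(1)[of H k K] abelian_section_normal[OF S] S cl
    by (auto simp: abelian_section_def)
  then show ?thesis by (simp add: asdim_bounded_by_series_def)
next
  case False
  \<comment> \<open>Failure at H excludes the first alternative for H. Failure at K bounds all k
    with \<open>P k\<close>, since the series to L continues to K.\<close>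
  then obtain k1 where k1: "\<not> closed_series_to H k1" "\<not> closed_series_to K k1" by blast
  define P where "P k \<longleftrightarrow> (\<exists>L. subgroup L G \<and> closedin T L \<and> H \<subseteq> L \<and> L \<subseteq> K \<and>
      closed_series_to L k \<and> asdim_at_most L k)" for k
  have sub: "subgroup H G" "subgroup K G" "H \<subseteq> K" using S by (auto simp: abelian_section_def)
  obtain k0 where "closed_series_to H k0" "asdim_at_most H k0"
    using H k1 by (auto simp: asdim_bounded_by_series_def)
  then have k0: "P k0" unfolding P_def using sub cl by blast
  have ext: "closed_series_to K k"
    if "subgroup L G" "H \<subseteq> L" "L \<subseteq> K" "closed_series_to L k" for L k
    using closed_series_to_extend(1)[OF that(4) sub(2) cl(2)]
      abelian_section_normal[OF abelian_section_mono[OF S that(1-3)]] by blast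
  have le: "k \<le> k1" if "P k" for k
  proof (rule ccontr)
    assume "\<not> k \<le> k1"
    moreover have "closed_series_to K k" using that ext unfolding P_def by blast
    ultimately show False using closed_series_to_mono[of K k k1] k1 by simp
  qed
  \<comment> \<open>With k maximal, no further discrete cyclic group can be adjoined to L, as this
    would yield \<open>P (Suc k)\<close>.\<close>
  define k where "k = (GREATEST k. P k)"
  have Pk: "P k" unfolding k_def using GreatestI_nat[of P k0 k1] k0 le by blast
  have max: "\<not> P (Suc k)"
    using Greatest_le_nat[of P "Suc k" k1] le unfolding k_def by (metis Suc_n_not_le_n)
  obtain L where L: "subgroup L G" "closedin T L" "H \<subseteq> L" "L \<subseteq> K"
      "closed_series_to L k" "asdim_at_most L k" using Pk unfolding P_def by blast
  have SL: "abelian_section L K" by (rule abelian_section_mono[OF S L(1,3,4)])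
  have cpt: "\<exists>Q. compactin T Q \<and> range (\<lambda>m::int. g [^] m) \<subseteq> L <#> Q" if g: "g \<in> K" for g
  proof (rule ccontr)
    assume "\<not> ?thesis"
    then have discrete: "finite (return_times L g C)" if "compactin T C" for C
      using recurrent_imp_relatively_compact[OF SL g that] by blast
    let ?M = "L <#> range (\<lambda>m::int. g [^] m)"
    note M = subgroup_adjoin[OF SL g]
    have clM: "closedin T ?M" by (rule closedin_adjoin_discrete[OF SL g discrete L(2)])
    have "L \<lhd> G\<lparr>carrier := ?M\<rparr>"
      by (rule normal_in_subgroup[OF L(1) M(1,2)]) (use M(4) abelian_section_conj[OF SL] in blast)
    then have "closed_series_to ?M (Suc k)"
      by (rule closed_series_to_extend(2)[OF L(5) M(1) clM])
        (rule infinite_cyclic_adjoin_discrete[OF SL g discrete], assumption)+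
    moreover have "asdim_at_most ?M (Suc k)"
      by (rule asdim_at_most_adjoin_discrete[OF SL g discrete L(6)])
    ultimately have "P (Suc k)" unfolding P_def using M clM L(3) by blast
    then show False using max by blast
  qed
  have "asdim_at_most K k"
  proof (rule asdim_at_most_locally_elliptic[OF L(6) _ sub(2)])
    show "L \<subseteq> carrier G" using L(1) subgroup.subset by blast
    show "\<exists>M Q. subgroup M G \<and> M \<subseteq> K \<and> C \<inter> K \<subseteq> M \<and> compactin T Q \<and> M \<subseteq> L <#> Q"
      if "compactin T C" for C
      by (rule locally_elliptic_section[OF SL cl(2) that cpt])
  qed
  moreover have "closed_series_to K k" by (rule ext[OF L(1,3-5)])
  ultimately show ?thesis unfolding asdim_bounded_by_series_def by blast
qed

text \<open>The terms of an abstract solvable series need not be closed, so the bound is stated for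
  their closures, to which the commutator condition passes.\<close>

lemma asdim_bounded_by_series_solvable:
  assumes N: "subgroup N G" and M: "solvable_seq (G\<lparr>carrier := N\<rparr>) M"
  shows "subgroup M G \<and> asdim_bounded_by_series (T closure_of M)"
  using M
proof (induction rule: solvable_seq.induct)
  case unity
  have "subgroup {\<one>} G" by (rule subgroupI) auto
  moreover have "T closure_of {\<one>} = {\<one>}" by (rule closure_of_closedin[OF closedin_one])
  ultimately show ?case
    using closed_series_to_one asdim_at_most_one by (auto simp: asdim_bounded_by_series_def)
next
  case (extension K H)
  have H: "subgroup H G" by (rule incl_subgroup[OF N extension.hyps(3)])
  have KH: "K \<lhd> G\<lparr>carrier := H\<rparr>" "comm_group (G\<lparr>carrier := H\<rparr> Mod K)"
    using extension.hyps by simp_all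
  have "derived G H \<subseteq> K" by (rule derived_of_subgroup_minimal[OF KH(1) H KH(2)])
  moreover have "x \<otimes> y \<otimes> inv x \<otimes> inv y \<in> derived G H" if "x \<in> H" "y \<in> H" for x y
    unfolding derived_def using that by (blast intro: generate.incl)
  moreover have "K \<subseteq> H"
    using subgroup.subset[OF normal_imp_subgroup[OF KH(1)]] by simp
  ultimately have "abelian_section K H"
    using H extension.IH by (auto simp: abelian_section_def)
  then have "asdim_bounded_by_series (T closure_of H)"
    using asdim_bounded_by_series_abelian_section abelian_section_closure_of extension.IH
      closedin_closure_of by blast
  then show ?case using H by blast
qed

section \<open>Compact quotients and the return to the coarse structure\<close>

text \<open>The quotient map is open, so the images of the translates \<open>V #> c\<close> form an
  open cover of the quotient. Finitely many of them suffice, and the corresponding translates of C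
  together meet every coset.\<close>

lemma compact_quotient_transversal:
  assumes N: "N \<lhd> G" and cpt: "compact_space (FactGroup_topology G T N)"
  obtains Q where "compactin T Q" "carrier G \<subseteq> N <#> Q"
proof -
  interpret N: normal N G by (rule N)
  let ?p = "\<lambda>x. N #> x" and ?X = "FactGroup_topology G T N"
  have top: "topspace ?X = ?p ` carrier G"
    using quotient_imp_surjective_map[OF quotient_map_FactGroup_topology[of N]]
    by (simp add: topspace_eq_carrier)
  obtain V C where V: "openin T V" "\<one> \<in> V" "V \<subseteq> C" "compactin T C"
    using relatively_compact_neighbourhood[OF one_closed] .
  have op: "openin ?X (?p ` (V #> c))" if c: "c \<in> carrier G" for c
  proof -
    let ?U = "V #> c"
    have U: "openin T ?U" by (rule openin_r_translate[OF V(1) c])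
    then have UG: "?U \<subseteq> carrier G" using openin_subset topspace_eq_carrier by metis
    have "{x \<in> carrier G. ?p x \<in> ?p ` ?U} = (\<Union>n\<in>N. ?U #> n)"
    proof (intro equalityI subsetI)
      fix x assume "x \<in> {x \<in> carrier G. ?p x \<in> ?p ` ?U}"
      then obtain u where x: "x \<in> carrier G" "u \<in> ?U" "N #> x = N #> u" by blast
      have u: "u \<in> carrier G" using x UG by auto
      have "\<one> \<otimes> x \<in> N #> u" using x(3) N.one_closed unfolding r_coset_def by blast
      then obtain n where n: "n \<in> N" "x = n \<otimes> u" using x by (auto simp: r_coset_def)
      have "x = u \<otimes> (inv u \<otimes> n \<otimes> u)" using n u N.mem_carrier by (simp add: m_assoc)
      moreover have "inv u \<otimes> n \<otimes> u \<in> N" using N.inv_op_closed1[OF u n(1)] .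
      ultimately show "x \<in> (\<Union>n\<in>N. ?U #> n)" using x(2) unfolding r_coset_def by blast
    next
      fix x assume "x \<in> (\<Union>n\<in>N. ?U #> n)"
      then obtain n u where n: "n \<in> N" "u \<in> ?U" "x = u \<otimes> n" unfolding r_coset_def by blast
      have u: "u \<in> carrier G" using n UG by auto
      have "x = (u \<otimes> n \<otimes> inv u) \<otimes> u" using n u N.mem_carrier by (simp add: m_assoc)
      moreover have nn: "u \<otimes> n \<otimes> inv u \<in> N" using N.inv_op_closed2[OF u n(1)] .
      ultimately have "x \<in> N #> u" unfolding r_coset_def by blast
      then have "N #> x = N #> u" using repr_independence[OF _ u N.subgroup_axioms] by simp
      moreover have "x \<in> carrier G" using n u N.mem_carrier by simp
      ultimately show "x \<in> {x \<in> carrier G. ?p x \<in> ?p ` ?U}" using n(2) by blast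
    qed
    moreover have "openin T (\<Union>n\<in>N. ?U #> n)"
      using openin_r_translate[OF U] N.mem_carrier by (intro openin_Union) auto
    ultimately show ?thesis
      using UG by (auto simp: openin_FactGroup_topology carrier_FactGroup)
  qed
  let ?\<U> = "(\<lambda>c. ?p ` (V #> c)) ` carrier G"
  have "topspace ?X \<subseteq> \<Union>?\<U>"
  proof
    fix y assume "y \<in> topspace ?X"
    then obtain c where c: "c \<in> carrier G" "y = ?p c" unfolding top by blast
    have "\<one> \<otimes> c \<in> V #> c" using V(2) unfolding r_coset_def by blast
    then have "c \<in> V #> c" using c by simp
    then show "y \<in> \<Union>?\<U>" using c by blast
  qed
  moreover have "openin ?X U" if "U \<in> ?\<U>" for U using that op by blast
  ultimately obtain \<F> where \<F>: "finite \<F>" "\<F> \<subseteq> ?\<U>" "topspace ?X \<subseteq> \<Union>\<F>"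
    using compactinD[OF cpt[unfolded compact_space_def], of ?\<U>] by auto
  obtain F where F: "F \<subseteq> carrier G" "finite F" "\<F> = (\<lambda>c. ?p ` (V #> c)) ` F"
    using finite_subset_image[OF \<F>(1,2)] by blast
  show thesis
  proof (rule that)
    show "compactin T (C <#> F)" using compactin_set_mult[OF V(4) compactin_finite[OF F(2,1)]] .
    show "carrier G \<subseteq> N <#> (C <#> F)"
    proof
      fix x assume x: "x \<in> carrier G"
      then have "?p x \<in> \<Union>\<F>" using \<F>(3) top by blast
      then obtain c u where cu: "c \<in> F" "u \<in> V #> c" "N #> x = N #> u" using F(3) by blast
      then obtain v where v: "v \<in> V" "u = v \<otimes> c" unfolding r_coset_def by blast
      have "\<one> \<otimes> x \<in> N #> u" using cu(3) N.one_closed unfolding r_coset_def by blast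
      then obtain n where n: "n \<in> N" "x = n \<otimes> u" using x by (auto simp: r_coset_def)
      then show "x \<in> N <#> (C <#> F)" using v V(3) cu(1) by (auto intro: set_multI)
    qed
  qed
qed

text \<open>After symmetrizing C, reachability in \<open>Y i\<close> is an equivalence relation, and
  its classes form the i-th family. A pair in E joining two classes is a C-step and would merge
  them; pairs within one class have displacement in D.\<close>

lemma asdim_le_of_asdim_at_most:
  assumes A: "asdim_at_most (carrier G) n"
  shows "asdim G T \<le> enat n"
proof -
  have "coarse_asdim_le (carrier G) (left_coarse_structure G T) n"
    unfolding coarse_asdim_le_def
  proof
    fix E assume E: "E \<in> left_coarse_structure G T"
    let ?d = "\<lambda>(x, y). inv x \<otimes> y"
    have EG: "E \<subseteq> carrier G \<times> carrier G" and Ec: "compactin T (T closure_of (?d ` E))"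
      using E by (auto simp: left_coarse_structure_def)
    define C where "C = symmetrization (T closure_of (?d ` E))"
    have C: "compactin T C" unfolding C_def by (rule compactin_symmetrization[OF Ec])
    have Cinv: "inv c \<in> C" if "c \<in> C" for c
      using that inv_in_symmetrization[OF compactin_subset_carrier[OF Ec]] unfolding C_def by blast
    have "?d ` E \<subseteq> T closure_of (?d ` E)"
      using EG by (intro closure_of_subset) (auto simp: topspace_eq_carrier)
    then have EC: "inv x \<otimes> y \<in> C" if "(x, y) \<in> E" for x y
      using that unfolding C_def symmetrization_def by blast
    obtain D Y where D: "compactin T D" and Y: "carrier G = (\<Union>i\<le>n. Y i)"
      and bd: "\<forall>i\<le>n. comps_bounded (Y i) C D"
      using A C unfolding asdim_at_most_def by blast
    define R where "R i = (chain_step (Y i) C)\<^sup>*" for i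
    have YG: "Y i \<subseteq> carrier G" if "i \<le> n" for i using Y that by blast
    have Rsym: "(y, x) \<in> R i" if "(x, y) \<in> R i" "i \<le> n" for x y i
      using chain_sym[OF _ YG[OF that(2)]] Cinv that(1) unfolding R_def by blast
    have Rtrans: "(x, z) \<in> R i" if "(x, y) \<in> R i" "(y, z) \<in> R i" for x y z i
      using that unfolding R_def by (rule rtrancl_trans)
    have RY: "y \<in> Y i" if "(x, y) \<in> R i" "x \<in> Y i" for x y i
      using that chain_in_set unfolding R_def by blast
    define \<U> where "\<U> i = (\<lambda>x. R i `` {x}) ` Y i" for i
    show "\<exists>\<U>. (\<Union>i\<le>n. \<Union>(\<U> i)) = carrier G \<and>
        (\<Union>i\<le>n. \<Union>A\<in>\<U> i. A \<times> A) \<in> left_coarse_structure G T \<and>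
        (\<forall>i\<le>n. \<forall>A\<in>\<U> i. \<forall>B\<in>\<U> i. A \<noteq> B \<longrightarrow> (A \<times> B) \<inter> E = {})"
    proof (intro exI[of _ \<U>] conjI allI impI ballI)
      have "\<Union>(\<U> i) = Y i" for i
      proof
        show "\<Union>(\<U> i) \<subseteq> Y i" unfolding \<U>_def using RY by blast
        have "(x, x) \<in> R i" for x by (simp add: R_def)
        then show "Y i \<subseteq> \<Union>(\<U> i)" unfolding \<U>_def by blast
      qed
      then show "(\<Union>i\<le>n. \<Union>(\<U> i)) = carrier G" using Y by simp
    next
      let ?B = "\<Union>i\<le>n. \<Union>A\<in>\<U> i. A \<times> A"
      have B: "y \<in> carrier G \<and> z \<in> carrier G \<and> inv y \<otimes> z \<in> D" if yz: "(y, z) \<in> ?B" for y z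
      proof -
        obtain i x where i: "i \<le> n" "x \<in> Y i" "(x, y) \<in> R i" "(x, z) \<in> R i"
          using yz unfolding \<U>_def by blast
        have "(y, z) \<in> R i" using Rtrans[OF Rsym[OF i(3,1)] i(4)] .
        moreover have "y \<in> Y i" "z \<in> Y i" using RY[OF i(3,2)] RY[OF i(4,2)] by simp_all
        ultimately show ?thesis using bd i(1) YG[OF i(1)] unfolding comps_bounded_def R_def by blast
      qed
      have "?d ` ?B \<subseteq> D"
      proof clarify
        fix i y z A assume "i \<le> n" "A \<in> \<U> i" "y \<in> A" "z \<in> A"
        then have "(y, z) \<in> ?B" by blast
        then show "inv y \<otimes> z \<in> D" using B by blast
      qed
      then have "T closure_of (?d ` ?B) \<subseteq> D"
        using compactin_imp_closedin[OF Hausdorff D] by (rule closure_of_minimal)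
      then have "compactin T (T closure_of (?d ` ?B))"
        using closed_compactin[OF D] closedin_closure_of by blast
      moreover have "?B \<subseteq> carrier G \<times> carrier G" using B by (intro subrelI) blast
      ultimately show "?B \<in> left_coarse_structure G T" unfolding left_coarse_structure_def by blast
    next
      fix i A B assume i: "i \<le> n" and AB: "A \<in> \<U> i" "B \<in> \<U> i" "A \<noteq> B"
      obtain x y where xy: "x \<in> Y i" "A = R i `` {x}" "y \<in> Y i" "B = R i `` {y}"
        using AB unfolding \<U>_def by blast
      have False if "(a, b) \<in> (A \<times> B) \<inter> E" for a b
      proof -
        have ab: "(x, a) \<in> R i" "(y, b) \<in> R i" "inv a \<otimes> b \<in> C" using that xy EC by auto
        then have "(a, b) \<in> chain_step (Y i) C" using RY xy unfolding chain_step_def by blast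
        then have "(a, b) \<in> R i" unfolding R_def by blast
        then have "(x, y) \<in> R i" using ab Rtrans Rsym i by meson
        then have "A = B" unfolding xy using Rtrans Rsym[OF _ i] by blast
        then show False using AB by blast
      qed
      then show "(A \<times> B) \<inter> E = {}" by fast
    qed
  qed
  then show ?thesis unfolding asdim_def coarse_asdim_def by (intro Inf_lower) blast
qed

lemma closed_series_to_le_hirsch_length:
  assumes "closed_series_to (carrier G) k"
  shows "enat k \<le> hirsch_length G T"
proof -
  obtain m H where "closed_subnormal_series G T m H" and k: "k \<le> card (infinite_cyclic_factors G m H)"
    using assms unfolding closed_series_to_def closed_subnormal_series_def by blast
  then have "enat (card (infinite_cyclic_factors G m H)) \<le> hirsch_length G T"
    unfolding hirsch_length_def by (intro Sup_upper) blast
  then show ?thesis using k by (meson enat_ord_simps(1) order_trans)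
qed

end

theorem corollary25:
  fixes G :: "('a, 'b) monoid_scheme" and T :: "'a topology"
  assumes "locally_compact_group G T"
    and "compactly_generated_group G T"
    and "solvable_by_compact G T"
  shows "asdim G T \<le> hirsch_length G T"
proof -
  interpret lc_group G T
    using assms(1) by (auto simp: locally_compact_group_def lc_group_def lc_group_axioms_def)
  obtain N where N: "N \<lhd> G" "closedin T N" "solvable (G\<lparr>carrier := N\<rparr>)"
      "compact_space (FactGroup_topology G T N)"
    using assms(3) by (auto simp: solvable_by_compact_def)
  have sub: "subgroup N G" using N(1) by (rule normal_imp_subgroup)
  have "solvable_seq (G\<lparr>carrier := N\<rparr>) N" using N(3) by (simp add: solvable_def)
  from asdim_bounded_by_series_solvable[OF sub this]
  have "asdim_bounded_by_series N" using N(2) by (simp add: closure_of_closedin)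
  \<comment> \<open>G is appended as the top term above N. Whatever the factor G/N is, the count
    does not drop.\<close>
  moreover have ext: "closed_series_to (carrier G) k" if "closed_series_to N k" for k
    using closed_series_to_extend(1)[OF that subgroup_self] N(1) topspace_eq_carrier closedin_topspace[of T]
    by simp
  ultimately consider "\<forall>k. closed_series_to (carrier G) k"
    | k where "closed_series_to (carrier G) k" "asdim_at_most N k"
    unfolding asdim_bounded_by_series_def by blast
  then show ?thesis
  proof cases
    case 1
    then have "enat k \<le> hirsch_length G T" for k using closed_series_to_le_hirsch_length by blast
    then have "hirsch_length G T = \<infinity>" by (metis enat_ile infinity_ileE not_infinity_eq Suc_ile_eq less_irrefl)
    then show ?thesis by simp
  next
    case 2
    \<comment> \<open>Compactness of G/N makes G a compact thickening of N, which has the same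
      dimension bound.\<close>
    obtain Q where Q: "compactin T Q" "carrier G \<subseteq> N <#>\<^bsub>G\<^esub> Q"
      using compact_quotient_transversal[OF N(1,4)] .
    have "asdim_at_most (N <#>\<^bsub>G\<^esub> Q) k"
      by (rule asdim_at_most_set_mult[OF 2(2) subgroup.subset[OF sub] Q(1)])
    then have "asdim G T \<le> enat k"
      using asdim_at_most_subset Q(2) asdim_le_of_asdim_at_most by blast
    then show ?thesis using closed_series_to_le_hirsch_length[OF 2(1)] order_trans by blast
  qed
qed

end
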